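(* Let $(X,q)$ be a rack with a $2$-cocycle, let $H$ be a Hopf algebra with a realization $W(q,X)\in{}^H_H\mathcal{YD}$, with coaction $w_x\mapsto\sum_{y\in X}e_{xy}\otimes w_y$, and let $K$ be the Hopf subalgebra of $H$ generated by $\{e_{xy}\}_{x,y\in X}$. For $z\in X$ let $\vartheta_z\in\operatorname{Alg}(K,\Bbbk)$ be the algebra map by which $K$ acts on the $K$-invariant line $\Bbbk w_z$, so $\vartheta_z(e_{xy})=\delta_{z\rhd x,y}\,q_{z,x}$ for $x,y\in X$. Then: (1) For every $z,t\in X$, $\vartheta_z\vartheta_t=\vartheta_t\vartheta_{t\rhd z}$. (2) The assignment $f_x\mapsto\vartheta_x$, $x\in X$, defines a group homomorphism $G_X^{op}\to\operatorname{Alg}(K,\Bbbk)$. (3) If $X$ is faithful, then $\{\vartheta_z\}_{z\in X}$ is linearly independent.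
   Context: $\Bbbk$ is an algebraically closed field of characteristic zero. A rack is a nonempty set $X$ with $\rhd:X\times X\to X$ such that $x\rhd(y\rhd z)=(x\rhd y)\rhd(x\rhd z)$ and every $\phi_x:y\mapsto x\rhd y$ is bijective; it is faithful if $\phi_x=\phi_y$ implies $x=y$. A $2$-cocycle is $q:X\times X\to\Bbbk^\times$ with $q_{x,y\rhd z}q_{y,z}=q_{x\rhd y,x\rhd z}q_{x,z}$. $W(q,X)$ has basis $\{w_x\}_{x\in X}$ and braiding $c(w_x\otimes w_y)=q_{y,x}\,w_y\otimes w_{y\rhd x}$. A realization over $H$ is a Yetter-Drinfeld structure over $H$ whose categorical braiding $v\otimes w\mapsto v_{(-1)}\cdot w\otimes v_{(0)}$ equals $c$. Each line $\Bbbk w_z$ is $K$-invariant. $\operatorname{Alg}(K,\Bbbk)$ is the group of algebra maps $K\to\Bbbk$ under the convolution product. $G_X$ is the group generated by $f_x$, $x\in X$, with relations $f_xf_y=f_{x\rhd y}f_x$. *)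

theory Defs
  imports
    "HOL-Computational_Algebra.Polynomial"
    "HOL-Library.Poly_Mapping"
    "HOL-Library.FuncSet"
    "HOL-Algebra.Group"
begin

section \<open>Free vector spaces and tensor products\<close>

text \<open>
  The vector space with basis \<open>'a\<close> is \<open>'a \<Rightarrow>\<^sub>0 'k\<close>; \<open>Poly_Mapping.single a 1\<close> is the basis vector of \<open>a\<close>.
\<close>

definition fscale :: "'k::field \<Rightarrow> ('a \<Rightarrow>\<^sub>0 'k) \<Rightarrow> ('a \<Rightarrow>\<^sub>0 'k)"
  where "fscale c t = Poly_Mapping.map ((*) c) t"

abbreviation fbasis :: "'a \<Rightarrow> ('a \<Rightarrow>\<^sub>0 'k::field)"
  where "fbasis a \<equiv> Poly_Mapping.single a 1"

lemma lookup_fscale [simp]: "Poly_Mapping.lookup (fscale c t) a = c * Poly_Mapping.lookup t a"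
  unfolding fscale_def by (simp add: Poly_Mapping.map.rep_eq when_def)

lemma vector_space_fscale: "vector_space (fscale :: 'k::field \<Rightarrow> ('a \<Rightarrow>\<^sub>0 'k) \<Rightarrow> _)"
  by unfold_locales (auto intro!: poly_mapping_eqI simp: lookup_add algebra_simps)

definition lin_ext :: "('k::field \<Rightarrow> 'v::ab_group_add \<Rightarrow> 'v) \<Rightarrow> ('a \<Rightarrow> 'v) \<Rightarrow> ('a \<Rightarrow>\<^sub>0 'k) \<Rightarrow> 'v"
  where "lin_ext s f t = (\<Sum>a\<in>Poly_Mapping.keys t. s (Poly_Mapping.lookup t a) (f a))"

text \<open>
  The tensor product of \<open>A\<close> and \<open>B\<close> is the quotient of the vector space \<open>('a \<times> 'b) \<Rightarrow>\<^sub>0 'k\<close> of formal sums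
  of symbols \<open>(a, b)\<close>, standing for \<open>a \<otimes> b\<close>, by the subspace \<open>tensor_null\<close> spanned by the bilinearity
  relations. Since the quotient depends on the scalar multiplications, it cannot be a type. Tensors are
  therefore given by representatives (as in Sweedler notation), and equality of tensors is \<open>tensor_eq\<close>.
  The threefold tensor product is treated in the same way.
\<close>

definition lin_rels :: "('k::field \<Rightarrow> 'v::ab_group_add \<Rightarrow> 'v) \<Rightarrow> ('v \<Rightarrow> 'p) \<Rightarrow> ('p \<Rightarrow>\<^sub>0 'k) set"
  where "lin_rels s i =
    {fbasis (i (u + v)) - fbasis (i u) - fbasis (i v) | u v. True} \<union>
    {fbasis (i (s c u)) - fscale c (fbasis (i u)) | c u. True}"

definition tensor_null ::
  "('k::field \<Rightarrow> 'a::ab_group_add \<Rightarrow> 'a) \<Rightarrow> ('k \<Rightarrow> 'b::ab_group_add \<Rightarrow> 'b) \<Rightarrow> (('a \<times> 'b) \<Rightarrow>\<^sub>0 'k) set"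
  where "tensor_null sa sb = module.span fscale
    ((\<Union>b. lin_rels sa (\<lambda>a. (a, b))) \<union> (\<Union>a. lin_rels sb (\<lambda>b. (a, b))))"

definition tensor_eq ::
  "('k::field \<Rightarrow> 'a::ab_group_add \<Rightarrow> 'a) \<Rightarrow> ('k \<Rightarrow> 'b::ab_group_add \<Rightarrow> 'b) \<Rightarrow>
    (('a \<times> 'b) \<Rightarrow>\<^sub>0 'k) \<Rightarrow> (('a \<times> 'b) \<Rightarrow>\<^sub>0 'k) \<Rightarrow> bool"
  where "tensor_eq sa sb t t' \<longleftrightarrow> t - t' \<in> tensor_null sa sb"

definition tensor3_null ::
  "('k::field \<Rightarrow> 'a::ab_group_add \<Rightarrow> 'a) \<Rightarrow> ('k \<Rightarrow> 'b::ab_group_add \<Rightarrow> 'b) \<Rightarrow>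
    ('k \<Rightarrow> 'c::ab_group_add \<Rightarrow> 'c) \<Rightarrow> (('a \<times> 'b \<times> 'c) \<Rightarrow>\<^sub>0 'k) set"
  where "tensor3_null sa sb sc = module.span fscale
    ((\<Union>b c. lin_rels sa (\<lambda>a. (a, b, c))) \<union> (\<Union>a c. lin_rels sb (\<lambda>b. (a, b, c))) \<union>
     (\<Union>a b. lin_rels sc (\<lambda>c. (a, b, c))))"

definition tensor3_eq ::
  "('k::field \<Rightarrow> 'a::ab_group_add \<Rightarrow> 'a) \<Rightarrow> ('k \<Rightarrow> 'b::ab_group_add \<Rightarrow> 'b) \<Rightarrow>
    ('k \<Rightarrow> 'c::ab_group_add \<Rightarrow> 'c) \<Rightarrow>
    (('a \<times> 'b \<times> 'c) \<Rightarrow>\<^sub>0 'k) \<Rightarrow> (('a \<times> 'b \<times> 'c) \<Rightarrow>\<^sub>0 'k) \<Rightarrow> bool"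
  where "tensor3_eq sa sb sc t t' \<longleftrightarrow> t - t' \<in> tensor3_null sa sb sc"


section \<open>Hopf algebras\<close>

text \<open>
  \<open>comul a\<close> is a representative of the coproduct of \<open>a\<close>; all axioms are equalities of tensors.
\<close>

locale hopf_algebra = vector_space scale
  for scale :: "'k::field \<Rightarrow> 'h::ring_1 \<Rightarrow> 'h" +
  fixes comul :: "'h \<Rightarrow> (('h \<times> 'h) \<Rightarrow>\<^sub>0 'k)"
    and counit :: "'h \<Rightarrow> 'k"
    and antipode :: "'h \<Rightarrow> 'h"
  assumes scale_mult_left: "scale c a * b = scale c (a * b)"
    and scale_mult_right: "a * scale c b = scale c (a * b)"
    and comul_add: "tensor_eq scale scale (comul (a + b)) (comul a + comul b)"
    and comul_scale: "tensor_eq scale scale (comul (scale c a)) (fscale c (comul a))"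
    and counit_linear: "Vector_Spaces.linear scale (*) counit"
    and coassoc: "tensor3_eq scale scale scale
      (lin_ext fscale (\<lambda>(x, y). lin_ext fscale (\<lambda>(u, v). fbasis (u, v, y)) (comul x)) (comul a))
      (lin_ext fscale (\<lambda>(x, y). lin_ext fscale (\<lambda>(u, v). fbasis (x, u, v)) (comul y)) (comul a))"
    and counit_left: "lin_ext scale (\<lambda>(x, y). scale (counit x) y) (comul a) = a"
    and counit_right: "lin_ext scale (\<lambda>(x, y). scale (counit y) x) (comul a) = a"
    and comul_mult: "tensor_eq scale scale (comul (a * b))
      (lin_ext fscale (\<lambda>(x, y). lin_ext fscale (\<lambda>(u, v). fbasis (x * u, y * v)) (comul b)) (comul a))"
    and comul_one: "tensor_eq scale scale (comul 1) (fbasis (1, 1))"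
    and counit_mult: "counit (a * b) = counit a * counit b"
    and counit_one: "counit 1 = 1"
    and antipode_linear: "Vector_Spaces.linear scale scale antipode"
    and antipode_left: "lin_ext scale (\<lambda>(x, y). antipode x * y) (comul a) = scale (counit a) 1"
    and antipode_right: "lin_ext scale (\<lambda>(x, y). x * antipode y) (comul a) = scale (counit a) 1"

text \<open>
  In \<open>hopf_subalgebra\<close>, the existence of a representative supported on \<open>B \<times> B\<close> says that the
  coproduct of \<open>a\<close> lies in the image of \<open>B \<otimes> B\<close>.
\<close>

definition hopf_subalgebra ::
  "('k::field \<Rightarrow> 'h::ring_1 \<Rightarrow> 'h) \<Rightarrow> ('h \<Rightarrow> (('h \<times> 'h) \<Rightarrow>\<^sub>0 'k)) \<Rightarrow> ('h \<Rightarrow> 'h) \<Rightarrow> 'h set \<Rightarrow> bool"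
  where "hopf_subalgebra scale comul antipode B \<longleftrightarrow>
    module.subspace scale B \<and> 1 \<in> B \<and> (\<forall>a\<in>B. \<forall>b\<in>B. a * b \<in> B) \<and>
    (\<forall>a\<in>B. \<exists>t. Poly_Mapping.keys t \<subseteq> B \<times> B \<and> tensor_eq scale scale (comul a) t) \<and>
    (\<forall>a\<in>B. antipode a \<in> B)"

definition hopf_subalgebra_generated ::
  "('k::field \<Rightarrow> 'h::ring_1 \<Rightarrow> 'h) \<Rightarrow> ('h \<Rightarrow> (('h \<times> 'h) \<Rightarrow>\<^sub>0 'k)) \<Rightarrow> ('h \<Rightarrow> 'h) \<Rightarrow> 'h set \<Rightarrow> 'h set"
  where "hopf_subalgebra_generated scale comul antipode E =
    \<Inter>{B. hopf_subalgebra scale comul antipode B \<and> E \<subseteq> B}"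

text \<open>
  Algebra maps from a Hopf subalgebra \<open>B\<close> to the base field are functions on \<open>B\<close>, so they are
  taken extensional. In the convolution product, \<open>t\<close> is a representative of the coproduct that
  lies in \<open>B \<otimes> B\<close>; for linear \<open>f\<close> and \<open>g\<close> the value does not depend on its choice.
\<close>

definition alg_maps :: "('k::field \<Rightarrow> 'h::ring_1 \<Rightarrow> 'h) \<Rightarrow> 'h set \<Rightarrow> ('h \<Rightarrow> 'k) set"
  where "alg_maps scale B = {f \<in> extensional B.
    (\<forall>a\<in>B. \<forall>b\<in>B. f (a + b) = f a + f b) \<and> (\<forall>c. \<forall>a\<in>B. f (scale c a) = c * f a) \<and>
    (\<forall>a\<in>B. \<forall>b\<in>B. f (a * b) = f a * f b) \<and> f 1 = 1}"

definition convolution ::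
  "('k::field \<Rightarrow> 'h::ring_1 \<Rightarrow> 'h) \<Rightarrow> ('h \<Rightarrow> (('h \<times> 'h) \<Rightarrow>\<^sub>0 'k)) \<Rightarrow> 'h set \<Rightarrow>
    ('h \<Rightarrow> 'k) \<Rightarrow> ('h \<Rightarrow> 'k) \<Rightarrow> 'h \<Rightarrow> 'k"
  where "convolution scale comul B f g = (\<lambda>a\<in>B. lin_ext (*) (\<lambda>(x, y). f x * g y)
    (SOME t. Poly_Mapping.keys t \<subseteq> B \<times> B \<and> tensor_eq scale scale (comul a) t))"

definition Alg ::
  "('k::field \<Rightarrow> 'h::ring_1 \<Rightarrow> 'h) \<Rightarrow> ('h \<Rightarrow> (('h \<times> 'h) \<Rightarrow>\<^sub>0 'k)) \<Rightarrow> ('h \<Rightarrow> 'k) \<Rightarrow> 'h set \<Rightarrow>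
    ('h \<Rightarrow> 'k) monoid"
  where "Alg scale comul counit B =
    \<lparr>carrier = alg_maps scale B, monoid.mult = convolution scale comul B, one = restrict counit B\<rparr>"


section \<open>Yetter-Drinfeld modules\<close>

text \<open>
  Left-left Yetter-Drinfeld modules. The last axiom is
  \<open>\<delta>(h v) = h\<^sub>1 v\<^sub>-\<^sub>1 S(h\<^sub>3) \<otimes> h\<^sub>2 v\<^sub>0\<close>.
\<close>

locale yetter_drinfeld =
  hopf_algebra scale comul counit antipode + V: vector_space scaleV
  for scale :: "'k::field \<Rightarrow> 'h::ring_1 \<Rightarrow> 'h"
    and comul :: "'h \<Rightarrow> (('h \<times> 'h) \<Rightarrow>\<^sub>0 'k)"
    and counit :: "'h \<Rightarrow> 'k"
    and antipode :: "'h \<Rightarrow> 'h"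
    and scaleV :: "'k \<Rightarrow> 'v::ab_group_add \<Rightarrow> 'v" +
  fixes act :: "'h \<Rightarrow> 'v \<Rightarrow> 'v"
    and coact :: "'v \<Rightarrow> (('h \<times> 'v) \<Rightarrow>\<^sub>0 'k)"
  assumes act_add_left: "act (a + b) v = act a v + act b v"
    and act_scale_left: "act (scale c a) v = scaleV c (act a v)"
    and act_linear: "Vector_Spaces.linear scaleV scaleV (act a)"
    and act_mult: "act (a * b) v = act a (act b v)"
    and act_one: "act 1 v = v"
    and coact_add: "tensor_eq scale scaleV (coact (v + v')) (coact v + coact v')"
    and coact_scale: "tensor_eq scale scaleV (coact (scaleV c v)) (fscale c (coact v))"
    and coact_coassoc: "tensor3_eq scale scale scaleV
      (lin_ext fscale (\<lambda>(x, u). lin_ext fscale (\<lambda>(y, z). fbasis (y, z, u)) (comul x)) (coact v))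
      (lin_ext fscale (\<lambda>(x, u). lin_ext fscale (\<lambda>(y, u'). fbasis (x, y, u')) (coact u)) (coact v))"
    and coact_counit: "lin_ext scaleV (\<lambda>(x, u). scaleV (counit x) u) (coact v) = v"
    and compatibility: "tensor_eq scale scaleV (coact (act h v))
      (lin_ext fscale (\<lambda>(h1, h').
        lin_ext fscale (\<lambda>(h2, h3).
          lin_ext fscale (\<lambda>(m, u). fbasis (h1 * m * antipode h3, act h2 u)) (coact v))
        (comul h'))
      (comul h))"

definition yd_braiding ::
  "('h \<Rightarrow> 'v \<Rightarrow> 'v) \<Rightarrow> ('v \<Rightarrow> (('h \<times> 'v) \<Rightarrow>\<^sub>0 'k::field)) \<Rightarrow> 'v \<Rightarrow> 'v \<Rightarrow> (('v \<times> 'v) \<Rightarrow>\<^sub>0 'k)"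
  where "yd_braiding act coact v w = lin_ext fscale (\<lambda>(m, u). fbasis (act m w, u)) (coact v)"


section \<open>Racks, cocycles and their realizations\<close>

text \<open>
  The underlying set of a rack is a whole type, hence nonempty; it need not be finite. The map
  \<open>\<phi>\<^sub>x\<close> is \<open>rop x\<close>, so that faithfulness of the rack is injectivity of \<open>rop\<close>.
\<close>

definition rack :: "('x \<Rightarrow> 'x \<Rightarrow> 'x) \<Rightarrow> bool"
  where "rack rop \<longleftrightarrow> (\<forall>x y z. rop x (rop y z) = rop (rop x y) (rop x z)) \<and> (\<forall>x. bij (rop x))"

definition faithful_rack :: "('x \<Rightarrow> 'x \<Rightarrow> 'x) \<Rightarrow> bool"
  where "faithful_rack rop \<longleftrightarrow> rack rop \<and> inj rop"

definition rack_cocycle :: "('x \<Rightarrow> 'x \<Rightarrow> 'x) \<Rightarrow> ('x \<Rightarrow> 'x \<Rightarrow> 'k::field) \<Rightarrow> bool"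
  where "rack_cocycle rop q \<longleftrightarrow> (\<forall>x y. q x y \<noteq> 0) \<and>
    (\<forall>x y z. q x (rop y z) * q y z = q (rop x y) (rop x z) * q x z)"

text \<open>
  The space \<open>W(q, X)\<close> is \<open>'x \<Rightarrow>\<^sub>0 'k\<close>, with \<open>w\<^sub>x = fbasis x\<close>. Two linear maps on its tensor
  square agree if they agree on all \<open>w\<^sub>x \<otimes> w\<^sub>y\<close>.
\<close>

definition realization ::
  "('x \<Rightarrow> 'x \<Rightarrow> 'x) \<Rightarrow> ('x \<Rightarrow> 'x \<Rightarrow> 'k::field) \<Rightarrow>
    ('k \<Rightarrow> 'h::ring_1 \<Rightarrow> 'h) \<Rightarrow> ('h \<Rightarrow> (('h \<times> 'h) \<Rightarrow>\<^sub>0 'k)) \<Rightarrow> ('h \<Rightarrow> 'k) \<Rightarrow> ('h \<Rightarrow> 'h) \<Rightarrow>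
    ('h \<Rightarrow> ('x \<Rightarrow>\<^sub>0 'k) \<Rightarrow> ('x \<Rightarrow>\<^sub>0 'k)) \<Rightarrow> (('x \<Rightarrow>\<^sub>0 'k) \<Rightarrow> (('h \<times> ('x \<Rightarrow>\<^sub>0 'k)) \<Rightarrow>\<^sub>0 'k)) \<Rightarrow> bool"
  where "realization rop q scale comul counit antipode act coact \<longleftrightarrow>
    yetter_drinfeld scale comul counit antipode fscale act coact \<and>
    (\<forall>x y. tensor_eq fscale fscale (yd_braiding act coact (fbasis x) (fbasis y))
      (fscale (q y x) (fbasis (fbasis y, fbasis (rop y x)))))"

text \<open>
  The coaction \<open>w\<^sub>x \<mapsto> \<Sum>\<^sub>y e\<^sub>x\<^sub>y \<otimes> w\<^sub>y\<close>. For each \<open>x\<close> only finitely many \<open>e x y\<close> are nonzero, as the sum is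
  an element of the tensor product.
\<close>

definition coaction_matrix ::
  "('k::field \<Rightarrow> 'h::ring_1 \<Rightarrow> 'h) \<Rightarrow> (('x \<Rightarrow>\<^sub>0 'k) \<Rightarrow> (('h \<times> ('x \<Rightarrow>\<^sub>0 'k)) \<Rightarrow>\<^sub>0 'k)) \<Rightarrow>
    ('x \<Rightarrow> 'x \<Rightarrow> 'h) \<Rightarrow> bool"
  where "coaction_matrix scale coact e \<longleftrightarrow> (\<forall>x. finite {y. e x y \<noteq> 0} \<and>
    tensor_eq scale fscale (coact (fbasis x)) (\<Sum>y | e x y \<noteq> 0. fbasis (e x y, fbasis y)))"

definition line_character ::
  "'h set \<Rightarrow> ('h \<Rightarrow> ('x \<Rightarrow>\<^sub>0 'k::field) \<Rightarrow> ('x \<Rightarrow>\<^sub>0 'k)) \<Rightarrow> 'x \<Rightarrow> 'h \<Rightarrow> 'k"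
  where "line_character K act z = (\<lambda>a\<in>K. THE c. act a (fbasis z) = fscale c (fbasis z))"

definition independent_family_on :: "'h set \<Rightarrow> ('x \<Rightarrow> 'h \<Rightarrow> 'k::field) \<Rightarrow> bool"
  where "independent_family_on K f \<longleftrightarrow> (\<forall>F c. finite F \<longrightarrow>
    (\<forall>a\<in>K. (\<Sum>x\<in>F. c x * f x a) = 0) \<longrightarrow> (\<forall>x\<in>F. c x = 0))"


section \<open>The enveloping group of a rack\<close>

text \<open>
  The presented group \<open>G\<^sub>X\<close> consists of words in the letters \<open>(x, True)\<close>, for \<open>f\<^sub>x\<close>, and \<open>(x, False)\<close>, for the
  inverse of \<open>f\<^sub>x\<close>, modulo the congruence generated by free cancellation and the defining relations.
\<close>

inductive rack_word_eq ::
  "('x \<Rightarrow> 'x \<Rightarrow> 'x) \<Rightarrow> ('x \<times> bool) list \<Rightarrow> ('x \<times> bool) list \<Rightarrow> bool"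
  for rop
  where
    refl: "rack_word_eq rop u u"
  | sym: "rack_word_eq rop u v \<Longrightarrow> rack_word_eq rop v u"
  | trans: "rack_word_eq rop u v \<Longrightarrow> rack_word_eq rop v w \<Longrightarrow> rack_word_eq rop u w"
  | cong: "rack_word_eq rop u v \<Longrightarrow> rack_word_eq rop (a @ u @ b) (a @ v @ b)"
  | cancel: "rack_word_eq rop [(x, s), (x, \<not> s)] []"
  | rel: "rack_word_eq rop [(x, True), (y, True)] [(rop x y, True), (x, True)]"

definition word_class :: "('x \<Rightarrow> 'x \<Rightarrow> 'x) \<Rightarrow> ('x \<times> bool) list \<Rightarrow> ('x \<times> bool) list set"
  where "word_class rop u = {v. rack_word_eq rop u v}"

definition enveloping_group :: "('x \<Rightarrow> 'x \<Rightarrow> 'x) \<Rightarrow> ('x \<times> bool) list set monoid"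
  where "enveloping_group rop =
    \<lparr>carrier = range (word_class rop),
     monoid.mult = (\<lambda>A B. \<Union>u\<in>A. \<Union>v\<in>B. word_class rop (u @ v)),
     one = word_class rop []\<rparr>"

definition env_gen :: "('x \<Rightarrow> 'x \<Rightarrow> 'x) \<Rightarrow> 'x \<Rightarrow> ('x \<times> bool) list set"
  where "env_gen rop x = word_class rop [(x, True)]"

definition opposite_group :: "'g monoid \<Rightarrow> 'g monoid"
  where "opposite_group G =
    \<lparr>carrier = carrier G, monoid.mult = (\<lambda>x y. y \<otimes>\<^bsub>G\<^esub> x), one = \<one>\<^bsub>G\<^esub>\<rparr>"

end

theory Submission
  imports Defs
begin

text \<open>
  Comparing the braiding of the realization with that of \<open>W(q, X)\<close> in coordinates shows how the
  coefficients act: \<open>e\<^sub>x\<^sub>y w\<^sub>z\<close> is \<open>q\<^sub>z\<^sub>,\<^sub>x w\<^sub>z\<close> if \<open>y = z \<rhd> x\<close>, and zero otherwise. The matrix \<open>S(e)\<close> is inverse to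
  \<open>e\<close>, and on each line \<open>e\<close> acts by a monomial matrix; hence the entries of all \<open>S\<^sup>n(e)\<close> act on
  the line by scalars (\<open>antipode_orbit_acts_diagonally\<close>). These entries generate \<open>K\<close> as an algebra, because the
  antipode reverses products and coproducts (\<open>hopf_subalgebra_generated_by_antipode_orbit\<close>). So \<open>K\<close>
  preserves the lines, and the characters \<open>\<theta>\<^sub>z\<close> are algebra maps with the stated values on the coefficients.

  The relation \<open>\<theta>\<^sub>z \<theta>\<^sub>t = \<theta>\<^sub>t \<theta>\<^bsub>t\<rhd>z\<^esub>\<close> holds because the braiding is \<open>H\<close>-linear (\<open>braiding_H_linear\<close>) and
  maps \<open>w\<^sub>z \<otimes> w\<^sub>t\<close> to a nonzero multiple of \<open>w\<^sub>t \<otimes> w\<^bsub>t\<rhd>z\<^esub>\<close>: the two products are the characters by which \<open>K\<close>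
  acts on these two lines. It is the relation that the universal property of \<open>G\<^sub>X\<close> asks for
  (\<open>enveloping_group_universal\<close>), once the algebra maps on \<open>K\<close> are known to form a group (\<open>group_Alg\<close>).
  If \<open>X\<close> is faithful, the values on the coefficients distinguish the characters, and
  distinct characters are linearly independent (\<open>independent_multiplicative_family\<close>).

  Tensors are given by representatives, so equalities between them are tested by multilinear forms with values in the
  field. Bilinear forms determine a tensor, and even whether it has a representative with prescribed support
  (\<open>tensor_supported_if_forms_vanish\<close>). All calculations in Sweedler notation thereby become
  calculations with scalars.
\<close>


section \<open>Linear and bilinear forms\<close>

lemma vector_space_mult: "vector_space ((*) :: 'k::field \<Rightarrow> 'k \<Rightarrow> 'k)"
  by unfold_locales (simp_all add: algebra_simps)

definition linear_form :: "('k::field \<Rightarrow> 'v::ab_group_add \<Rightarrow> 'v) \<Rightarrow> ('v \<Rightarrow> 'k) \<Rightarrow> bool"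
  where "linear_form s f \<longleftrightarrow> (\<forall>u v. f (u + v) = f u + f v) \<and> (\<forall>c u. f (s c u) = c * f u)"

definition bilinear_form ::
  "('k::field \<Rightarrow> 'a::ab_group_add \<Rightarrow> 'a) \<Rightarrow> ('k \<Rightarrow> 'b::ab_group_add \<Rightarrow> 'b) \<Rightarrow> ('a \<Rightarrow> 'b \<Rightarrow> 'k) \<Rightarrow> bool"
  where "bilinear_form sa sb B \<longleftrightarrow>
    (\<forall>y. linear_form sa (\<lambda>x. B x y)) \<and> (\<forall>x. linear_form sb (B x))"

definition trilinear_form ::
  "('k::field \<Rightarrow> 'a::ab_group_add \<Rightarrow> 'a) \<Rightarrow> ('k \<Rightarrow> 'b::ab_group_add \<Rightarrow> 'b) \<Rightarrow>
    ('k \<Rightarrow> 'c::ab_group_add \<Rightarrow> 'c) \<Rightarrow> ('a \<Rightarrow> 'b \<Rightarrow> 'c \<Rightarrow> 'k) \<Rightarrow> bool"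
  where "trilinear_form sa sb sc T \<longleftrightarrow>
    (\<forall>z. bilinear_form sa sb (\<lambda>x y. T x y z)) \<and> (\<forall>x y. linear_form sc (T x y))"

lemmas form_defs = linear_form_def bilinear_form_def trilinear_form_def

lemma linear_form_add: "linear_form s f \<Longrightarrow> f (u + v) = f u + f v"
  and linear_form_scale: "linear_form s f \<Longrightarrow> f (s c u) = c * f u"
  by (auto simp: linear_form_def)

lemma linear_form_zero: "linear_form s f \<Longrightarrow> f 0 = 0"
  using linear_form_add[of s f 0 0] by (metis add.right_neutral add_cancel_right_right)

lemma linear_form_diff: "linear_form s f \<Longrightarrow> f (u - v) = f u - f v"
  using linear_form_add[of s f "u - v" v] by (simp add: eq_diff_eq)

lemma linear_form_sum: "linear_form s f \<Longrightarrow> f (sum g A) = (\<Sum>a\<in>A. f (g a))"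
  by (induction A rule: infinite_finite_induct) (auto simp: linear_form_zero linear_form_add)

lemma linear_form_iff_linear:
  "vector_space s \<Longrightarrow> linear_form s f \<longleftrightarrow> Vector_Spaces.linear s (*) f"
  by (simp add: linear_form_def Vector_Spaces.linear_iff vector_space_mult)

lemma bilinear_formD:
  assumes "bilinear_form sa sb B"
  shows "B (x + x') y = B x y + B x' y" "B (sa c x) y = c * B x y"
    "B x (y + y') = B x y + B x y'" "B x (sb c y) = c * B x y"
  using assms by (auto simp: form_defs)

lemma trilinear_formD:
  assumes "trilinear_form sa sb sc T"
  shows "T (x + x') y z = T x y z + T x' y z" "T (sa c x) y z = c * T x y z"
    "T x (y + y') z = T x y z + T x y' z" "T x (sb c y) z = c * T x y z"
    "T x y (z + z') = T x y z + T x y z'" "T x y (sc c z) = c * T x y z"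
  using assms by (auto simp: form_defs)

text \<open>
  Over a field a maximal independent subset of \<open>S\<close> stays independent when \<open>d\<close> is added to it, so a linear
  form can be prescribed freely on the enlarged set.
\<close>

lemma exists_separating_form:
  assumes "vector_space s" and "d \<notin> module.span s S"
  shows "\<exists>f. linear_form s f \<and> (\<forall>x\<in>S. f x = 0) \<and> f d = 1"
proof -
  interpret V: vector_space s by fact
  interpret P: vector_space_pair s "(*) :: 'a \<Rightarrow> 'a \<Rightarrow> 'a"
    by (intro vector_space_pair.intro assms(1) vector_space_mult)
  obtain B where B: "B \<subseteq> S" "V.independent B" "S \<subseteq> V.span B"
    using V.maximal_independent_subset by blast
  have d: "d \<notin> V.span B" using assms(2) B(1) V.span_mono by blast
  then have "V.independent (insert d B)" using B(2) by (simp add: V.independent_insert)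
  then obtain g where g: "Vector_Spaces.linear s (*) g"
      "\<forall>x\<in>insert d B. g x = (if x = d then 1 else 0)"
    using P.linear_independent_extend[of "insert d B" "\<lambda>x. if x = d then 1 else 0"] by blast
  have "g x = 0" if "x \<in> B" for x
    using g(2) that d V.span_base[of x B] by auto
  then have "g x = 0" if "x \<in> V.span B" for x
    using P.linear_eq_on_span[OF g(1) P.linear_zero, of B x] that by auto
  then show ?thesis
    using g B(3) assms(1) by (auto simp: linear_form_iff_linear)
qed

lemma linear_forms_separate:
  assumes "vector_space s" and "\<And>f. linear_form s f \<Longrightarrow> f a = f b"
  shows "a = b"
proof (rule ccontr)
  interpret V: vector_space s by fact
  assume "a \<noteq> b"
  then have "a - b \<notin> V.span {}" by simp
  from exists_separating_form[OF assms(1) this] obtain f where "linear_form s f" "f (a - b) = 1"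
    by blast
  then show False using assms(2)[of f] by (simp add: linear_form_diff)
qed

text \<open>
  Algebra maps on a Hopf subalgebra \<open>K\<close> are linear on \<open>K\<close> only. Extending them to the whole Hopf algebra makes
  their convolution a sum over an arbitrary representative of the coproduct, with no
  reference to a representative inside \<open>K \<otimes> K\<close>.
\<close>

lemma extend_linear_form:
  assumes "vector_space s" and K: "module.subspace s K"
    and add: "\<And>a b. a \<in> K \<Longrightarrow> b \<in> K \<Longrightarrow> f (a + b) = f a + f b"
    and scl: "\<And>c a. a \<in> K \<Longrightarrow> f (s c a) = c * f a"
  shows "\<exists>g. linear_form s g \<and> (\<forall>a\<in>K. g a = f a)"
proof -
  interpret V: vector_space s by fact
  interpret P: vector_space_pair s "(*) :: 'a \<Rightarrow> 'a \<Rightarrow> 'a"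
    by (intro vector_space_pair.intro assms(1) vector_space_mult)
  obtain B where B: "B \<subseteq> K" "V.independent B" "K \<subseteq> V.span B"
    using V.maximal_independent_subset by blast
  obtain g where g: "Vector_Spaces.linear s (*) g" "\<forall>x\<in>B. g x = f x"
    using P.linear_independent_extend[OF B(2), of f] by blast
  have lg: "linear_form s g" using g(1) assms(1) by (simp add: linear_form_iff_linear)
  have f0: "f 0 = 0" using scl[of 0 0] V.subspace_0[OF K] by simp
  have "a \<in> K \<and> g a = f a" if "a \<in> V.span B" for a
    using that
  proof (induction rule: V.span_induct_alt)
    case base
    then show ?case using f0 lg V.subspace_0[OF K] by (simp add: linear_form_zero)
  next
    case (step c x y)
    then show ?case using B(1) g(2)
      by (auto simp: linear_form_add[OF lg] linear_form_scale[OF lg] add scl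
          V.subspace_add[OF K] V.subspace_scale[OF K])
  qed
  then show ?thesis using lg B(3) by blast
qed


section \<open>Evaluating forms on tensors\<close>

lemma lin_ext_superset:
  fixes s :: "'k::field \<Rightarrow> 'v::ab_group_add \<Rightarrow> 'v"
  assumes "vector_space s" "finite A" "Poly_Mapping.keys t \<subseteq> A"
  shows "lin_ext s f t = (\<Sum>a\<in>A. s (Poly_Mapping.lookup t a) (f a))"
proof -
  interpret V: vector_space s by fact
  show ?thesis unfolding lin_ext_def
    using assms(2,3) by (intro sum.mono_neutral_left) (auto simp: in_keys_iff)
qed

lemma linear_form_lin_ext: "linear_form fscale (lin_ext (*) g)"
  unfolding linear_form_def
proof (intro conjI allI)
  fix t t' :: "'b \<Rightarrow>\<^sub>0 'a" and c
  let ?A = "Poly_Mapping.keys t \<union> Poly_Mapping.keys t'"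
  have sup: "lin_ext (*) g u = (\<Sum>a\<in>?A. Poly_Mapping.lookup u a * g a)"
    if "Poly_Mapping.keys u \<subseteq> ?A" for u
    using that by (intro lin_ext_superset vector_space_mult) auto
  have "Poly_Mapping.keys (t + t') \<subseteq> ?A" by (rule Poly_Mapping.keys_add)
  then show "lin_ext (*) g (t + t') = lin_ext (*) g t + lin_ext (*) g t'"
    by (simp add: sup lookup_add algebra_simps sum.distrib)
  have "Poly_Mapping.keys (fscale c t) \<subseteq> ?A" by (auto simp: in_keys_iff)
  then show "lin_ext (*) g (fscale c t) = c * lin_ext (*) g t"
    by (simp add: sup sum_distrib_left algebra_simps)
qed

lemma lin_ext_fbasis [simp]: "lin_ext (*) g (fbasis a) = g a"
  by (simp add: lin_ext_def)

lemma linear_form_of_lin_ext: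
  assumes "linear_form s \<phi>"
  shows "\<phi> (lin_ext s f t) = lin_ext (*) (\<lambda>a. \<phi> (f a)) t"
  using assms by (simp add: lin_ext_def linear_form_sum linear_form_scale)

lemma lin_ext_lin_ext:
  "lin_ext (*) g (lin_ext fscale f t) = lin_ext (*) (\<lambda>a. lin_ext (*) g (f a)) t"
  by (rule linear_form_of_lin_ext[OF linear_form_lin_ext])

lemma linear_form_lookup: "linear_form fscale (\<lambda>t. Poly_Mapping.lookup t a)"
  by (simp add: linear_form_def lookup_add)

text \<open>
  \<open>ev2 B t\<close> is the value at the tensor \<open>t\<close> of the linear form on the tensor product that is
  induced by \<open>B\<close>; for bilinear \<open>B\<close> it only depends on the class of \<open>t\<close>.
\<close>

definition ev2 :: "('a \<Rightarrow> 'b \<Rightarrow> 'k::field) \<Rightarrow> (('a \<times> 'b) \<Rightarrow>\<^sub>0 'k) \<Rightarrow> 'k"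
  where "ev2 B t = lin_ext (*) (\<lambda>(x, y). B x y) t"

definition ev3 :: "('a \<Rightarrow> 'b \<Rightarrow> 'c \<Rightarrow> 'k::field) \<Rightarrow> (('a \<times> 'b \<times> 'c) \<Rightarrow>\<^sub>0 'k) \<Rightarrow> 'k"
  where "ev3 T t = lin_ext (*) (\<lambda>(x, y, z). T x y z) t"

lemma ev2_add: "ev2 (\<lambda>x y. B x y + C x y) t = ev2 B t + ev2 C t"
  by (auto simp: ev2_def lin_ext_def case_prod_unfold algebra_simps sum.distrib)

lemma ev2_cmult: "ev2 (\<lambda>x y. c * B x y) t = c * ev2 B t"
  by (auto simp: ev2_def lin_ext_def case_prod_unfold sum_distrib_left algebra_simps)

lemma ev2_mult_right: "ev2 (\<lambda>x y. B x y * c) t = ev2 B t * c"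
  using ev2_cmult[of c B t] by (simp add: mult.commute)

lemma ev2_cong:
  assumes "\<And>x y. (x, y) \<in> Poly_Mapping.keys t \<Longrightarrow> B x y = C x y"
  shows "ev2 B t = ev2 C t"
  unfolding ev2_def lin_ext_def using assms by (intro sum.cong) auto

lemma ev2_swap: "ev2 (\<lambda>x y. ev2 (\<lambda>u v. F x y u v) t') t = ev2 (\<lambda>u v. ev2 (\<lambda>x y. F x y u v) t) t'"
  unfolding ev2_def lin_ext_def case_prod_unfold
  by (simp add: sum_distrib_left, subst sum.swap) (simp add: ac_simps)

lemma linear_form_ev2: "linear_form fscale (ev2 B)"
  unfolding ev2_def by (rule linear_form_lin_ext)

lemma linear_form_ev3: "linear_form fscale (ev3 T)"
  unfolding ev3_def by (rule linear_form_lin_ext)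

lemma linear_form_vanishes_on_span:
  assumes "linear_form s f" "vector_space s" "\<And>x. x \<in> S \<Longrightarrow> f x = 0" "x \<in> module.span s S"
  shows "f x = 0"
proof -
  interpret V: vector_space s by fact
  from assms(4) show ?thesis
    by (induction rule: V.span_induct_alt)
      (simp_all add: assms(3) linear_form_add[OF assms(1)] linear_form_scale[OF assms(1)]
        linear_form_zero[OF assms(1)])
qed

lemma ev2_tensor_eq:
  assumes B: "bilinear_form sa sb B" and "tensor_eq sa sb t t'"
  shows "ev2 B t = ev2 B t'"
proof -
  note [simp] = bilinear_formD[OF B] linear_form_diff[OF linear_form_ev2] linear_form_scale[OF linear_form_ev2]
  have [simp]: "ev2 B (fbasis (x, y)) = B x y" for x y by (simp add: ev2_def)
  have "ev2 B (t - t') = 0"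
    using assms(2) unfolding tensor_eq_def tensor_null_def
    by (rule linear_form_vanishes_on_span[OF linear_form_ev2 vector_space_fscale, rotated])
       (auto simp: lin_rels_def)
  then show ?thesis by simp
qed

lemma ev3_tensor3_eq:
  assumes T: "trilinear_form sa sb sc T" and "tensor3_eq sa sb sc t t'"
  shows "ev3 T t = ev3 T t'"
proof -
  note [simp] = trilinear_formD[OF T] linear_form_diff[OF linear_form_ev3] linear_form_scale[OF linear_form_ev3]
  have [simp]: "ev3 T (fbasis (x, y, z)) = T x y z" for x y z by (simp add: ev3_def)
  have "ev3 T (t - t') = 0"
    using assms(2) unfolding tensor3_eq_def tensor3_null_def
    by (rule linear_form_vanishes_on_span[OF linear_form_ev3 vector_space_fscale, rotated])
       (auto simp: lin_rels_def)
  then show ?thesis by simp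
qed

lemma lin_rels_add: "fbasis (i (u + v)) - fbasis (i u) - fbasis (i v) \<in> lin_rels s i"
  and lin_rels_scale: "fbasis (i (s c u)) - fscale c (fbasis (i u)) \<in> lin_rels s i"
  unfolding lin_rels_def by blast+

text \<open>
  This is how the existence of representatives is proved without manipulating tensors: if no
  representative of \<open>d\<close> were supported on \<open>P\<close>, a linear form on the free vector space would vanish on the
  bilinearity relations and on \<open>P\<close> but not at \<open>d\<close>; vanishing on the relations says that it comes from a bilinear form.
\<close>

lemma tensor_supported_if_forms_vanish:
  fixes sa :: "'k::field \<Rightarrow> 'a::ab_group_add \<Rightarrow> 'a" and sb :: "'k \<Rightarrow> 'b::ab_group_add \<Rightarrow> 'b"
  assumes "\<And>B. bilinear_form sa sb B \<Longrightarrow> (\<And>x y. (x, y) \<in> P \<Longrightarrow> B x y = 0) \<Longrightarrow> ev2 B d = 0"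
  shows "\<exists>t. Poly_Mapping.keys t \<subseteq> P \<and> tensor_eq sa sb d t"
proof -
  interpret F: vector_space "fscale :: 'k \<Rightarrow> ('a \<times> 'b \<Rightarrow>\<^sub>0 'k) \<Rightarrow> _" by (rule vector_space_fscale)
  define R where "R = (\<Union>b. lin_rels sa (\<lambda>a. (a, b))) \<union> (\<Union>a. lin_rels sb (\<lambda>b. (a, b::'b)))"
  have "d \<in> F.span (R \<union> fbasis ` P)"
  proof (rule ccontr)
    assume "d \<notin> F.span (R \<union> fbasis ` P)"
    from exists_separating_form[OF vector_space_fscale this] obtain f where
      f: "linear_form fscale f" "\<And>x. x \<in> R \<union> fbasis ` P \<Longrightarrow> f x = 0" "f d = 1" by blast
    define B where "B = (\<lambda>x y. f (fbasis (x, y)))"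
    have left: "f r = 0" if "r \<in> lin_rels sa (\<lambda>a. (a, y))" for r y
      using that by (intro f(2)) (auto simp only: R_def)
    have right: "f r = 0" if "r \<in> lin_rels sb (\<lambda>b. (x, b))" for r x
      using that by (intro f(2)) (auto simp only: R_def)
    have z: "f (fbasis (x + x', y) - fbasis (x, y) - fbasis (x', y)) = 0"
        "f (fbasis (sa c x, y) - fscale c (fbasis (x, y))) = 0"
        "f (fbasis (x, y + y') - fbasis (x, y) - fbasis (x, y')) = 0"
        "f (fbasis (x, sb c y) - fscale c (fbasis (x, y))) = 0" for x x' y y' c
      using lin_rels_add[of "\<lambda>a. (a, y)" x x' sa] lin_rels_scale[of "\<lambda>a. (a, y)" sa c x]
        lin_rels_add[of "\<lambda>b. (x, b)" y y' sb] lin_rels_scale[of "\<lambda>b. (x, b)" sb c y]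
      by (blast intro: left right)+
    have "bilinear_form sa sb B"
      using z by (auto simp: form_defs B_def linear_form_add[OF f(1)] linear_form_diff[OF f(1)] linear_form_scale[OF f(1)] algebra_simps)
    moreover have "B x y = 0" if "(x, y) \<in> P" for x y
      using f(2) that by (auto simp: B_def)
    moreover have "ev2 B d = f d"
    proof -
      \<comment> \<open>A linear form on the free vector space is determined by its values on the basis.\<close>
      have "f t = ev2 B t" for t
      proof -
        have "t = (\<Sum>p\<in>Poly_Mapping.keys t. fscale (Poly_Mapping.lookup t p) (fbasis p))"
          by (rule poly_mapping_eqI)
              (simp add: lookup_sum lookup_single when_def if_distrib[of "(*) _"] in_keys_iff cong: if_cong)
        then have "f t = (\<Sum>p\<in>Poly_Mapping.keys t. Poly_Mapping.lookup t p * f (fbasis p))"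
          using linear_form_sum[OF f(1)] linear_form_scale[OF f(1)] by (metis (no_types, lifting) sum.cong)
        then show ?thesis by (simp add: ev2_def lin_ext_def B_def case_prod_unfold)
      qed
      then show ?thesis by simp
    qed
    ultimately show False using assms f(3) by simp
  qed
  then obtain r t where rt: "d = r + t" "r \<in> F.span R" "t \<in> F.span (fbasis ` P)"
    unfolding F.span_Un by blast
  have "Poly_Mapping.keys t \<subseteq> P" using rt(3)
  proof (induction rule: F.span_induct_alt)
    case (step c x y)
    have "Poly_Mapping.keys (fscale c x + y) \<subseteq> Poly_Mapping.keys x \<union> Poly_Mapping.keys y"
      by (auto simp: in_keys_iff lookup_add)
    with step show ?case by auto
  qed simp
  then show ?thesis using rt by (auto simp: tensor_eq_def tensor_null_def R_def)
qed


section \<open>Sweedler calculus\<close>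

context hopf_algebra
begin

text \<open>
  \<open>sw a B\<close> is the Sweedler sum of \<open>B a\<^sub>1 a\<^sub>2\<close>. Written with scalar-valued multilinear forms, the axioms of a
  Hopf algebra become equations between scalars, in which representatives of tensors no longer occur.
\<close>

definition sw :: "'h \<Rightarrow> ('h \<Rightarrow> 'h \<Rightarrow> 'k) \<Rightarrow> 'k"
  where "sw a B = ev2 B (comul a)"

abbreviation "lin \<equiv> linear_form scale"
abbreviation "bilin \<equiv> bilinear_form scale scale"
abbreviation "trilin \<equiv> trilinear_form scale scale scale"

lemma sw_cadd: "sw a (\<lambda>x y. B x y + C x y) = sw a B + sw a C"
  and sw_cmult: "sw a (\<lambda>x y. c * B x y) = c * sw a B"
  and sw_mult_right: "sw a (\<lambda>x y. B x y * c) = sw a B * c"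
  by (simp_all add: sw_def ev2_add ev2_cmult ev2_mult_right)

lemma sw_zero [simp]: "sw a (\<lambda>x y. 0) = 0"
  using sw_cmult[of a 0 "\<lambda>x y. 0"] by simp

lemma sw_swap: "sw a (\<lambda>x y. sw b (\<lambda>u v. F x y u v)) = sw b (\<lambda>u v. sw a (\<lambda>x y. F x y u v))"
  unfolding sw_def by (rule ev2_swap)

lemma sw_add: "bilin B \<Longrightarrow> sw (a + b) B = sw a B + sw b B"
  unfolding sw_def using ev2_tensor_eq[OF _ comul_add] by (simp add: linear_form_add[OF linear_form_ev2])

lemma sw_scale: "bilin B \<Longrightarrow> sw (scale c a) B = c * sw a B"
  unfolding sw_def using ev2_tensor_eq[OF _ comul_scale] by (simp add: linear_form_scale[OF linear_form_ev2])

lemma linear_sw: "bilin B \<Longrightarrow> lin (\<lambda>a. sw a B)"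
  by (simp add: linear_form_def sw_add sw_scale)

lemma sw_mult: "bilin B \<Longrightarrow> sw (a * b) B = sw a (\<lambda>x y. sw b (\<lambda>u v. B (x * u) (y * v)))"
  unfolding sw_def using ev2_tensor_eq[OF _ comul_mult]
  by (simp add: ev2_def lin_ext_lin_ext case_prod_unfold)

lemma sw_one: "bilin B \<Longrightarrow> sw 1 B = B 1 1"
  unfolding sw_def using ev2_tensor_eq[OF _ comul_one] by (simp add: ev2_def)

lemma sw_coassoc:
  "trilin T \<Longrightarrow> sw a (\<lambda>x y. sw x (\<lambda>u v. T u v y)) = sw a (\<lambda>x y. sw y (\<lambda>u v. T x u v))"
  unfolding sw_def using ev3_tensor3_eq[OF _ coassoc]
  by (simp add: ev2_def ev3_def lin_ext_lin_ext case_prod_unfold)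

lemma sw_counit_left: "lin f \<Longrightarrow> sw a (\<lambda>x y. counit x * f y) = f a"
  using linear_form_of_lin_ext[of scale f "\<lambda>(x, y). scale (counit x) y" "comul a"]
  unfolding sw_def counit_left by (simp add: ev2_def case_prod_unfold linear_form_scale)

lemma sw_counit_right: "lin f \<Longrightarrow> sw a (\<lambda>x y. counit y * f x) = f a"
  using linear_form_of_lin_ext[of scale f "\<lambda>(x, y). scale (counit y) x" "comul a"]
  unfolding sw_def counit_right by (simp add: ev2_def case_prod_unfold linear_form_scale)

lemma sw_antipode_left: "lin f \<Longrightarrow> sw a (\<lambda>x y. f (antipode x * y)) = counit a * f 1"
  using linear_form_of_lin_ext[of scale f "\<lambda>(x, y). antipode x * y" "comul a"]
  unfolding sw_def antipode_left by (simp add: ev2_def case_prod_unfold linear_form_scale)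

lemma sw_antipode_right: "lin f \<Longrightarrow> sw a (\<lambda>x y. f (x * antipode y)) = counit a * f 1"
  using linear_form_of_lin_ext[of scale f "\<lambda>(x, y). x * antipode y" "comul a"]
  unfolding sw_def antipode_right by (simp add: ev2_def case_prod_unfold linear_form_scale)

lemma lin_simps:
  "antipode (a + b) = antipode a + antipode b" "antipode (scale c a) = scale c (antipode a)"
  "counit (a + b) = counit a + counit b" "counit (scale c a) = c * counit a"
  using antipode_linear counit_linear by (auto simp: Vector_Spaces.linear_iff)

lemmas form_simps = form_defs lin_simps sw_cadd sw_cmult sw_mult_right sw_add sw_scale
  distrib_left distrib_right scale_mult_left scale_mult_right mult.left_commute[of _ "_::'k"]

lemma forms_separate: "(\<And>f. lin f \<Longrightarrow> f a = f b) \<Longrightarrow> a = b"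
  by (rule linear_forms_separate[OF vector_space_axioms])

lemma linear_antipode: "lin f \<Longrightarrow> lin (\<lambda>a. f (antipode a))"
  by (simp add: linear_form_def lin_simps)

lemma linear_counit: "lin counit"
  by (simp add: linear_form_def lin_simps)

text \<open>
  In \<open>Hom(H \<otimes> H, H)\<close>, both \<open>S(ab)\<close> and \<open>S(b)S(a)\<close> are convolution inverses of the product. Accordingly, both
  sides are obtained by collapsing \<open>S(a\<^sub>1b\<^sub>1) a\<^sub>2b\<^sub>2 S(b\<^sub>3) S(a\<^sub>3)\<close>, from the left and from the right.
\<close>

lemma antipode_mult: "antipode (a * b) = antipode b * antipode a"
proof (rule forms_separate)
  fix f assume f: "lin f"
  note [simp] = linear_form_add[OF f] linear_form_scale[OF f]
  let ?S = antipode
  define U where "U x y z u v w = f (?S (x * u) * (y * v) * ?S w * ?S z)" for x y z u v w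
  have tri1: "trilin (\<lambda>x y z. sw b (\<lambda>d w. sw d (\<lambda>u v. U x y z u v w)))"
    unfolding U_def by (simp add: form_simps)
  have tri2: "trilin (\<lambda>u v w. U x y z u v w)" for x y z
    unfolding U_def by (simp add: form_simps)
  have "f (?S b * ?S a) = sw a (\<lambda>c z. counit c * f (?S b * ?S z))"
    by (rule sw_counit_left[symmetric]) (simp add: form_simps)
  also have "\<dots> = sw a (\<lambda>c z. counit c * sw b (\<lambda>d w. counit d * f (?S w * ?S z)))"
  proof -
    have "sw b (\<lambda>d w. counit d * f (?S w * ?S z)) = f (?S b * ?S z)" for z
      by (rule sw_counit_left) (simp add: form_simps)
    then show ?thesis by simp
  qed
  also have "\<dots> = sw a (\<lambda>c z. sw b (\<lambda>d w. sw (c * d) (\<lambda>p r. f (?S p * r * ?S w * ?S z))))"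
  proof -
    have "sw (c * d) (\<lambda>p r. f (?S p * r * ?S w * ?S z)) = counit (c * d) * f (1 * ?S w * ?S z)" for c d w z
      by (rule sw_antipode_left) (simp add: form_simps)
    then show ?thesis by (simp add: counit_mult sw_cmult mult.assoc)
  qed
  also have "\<dots> = sw a (\<lambda>c z. sw b (\<lambda>d w. sw c (\<lambda>x y. sw d (\<lambda>u v. U x y z u v w))))"
    by (subst sw_mult) (simp_all add: form_simps U_def)
  also have "\<dots> = sw a (\<lambda>c z. sw c (\<lambda>x y. sw b (\<lambda>d w. sw d (\<lambda>u v. U x y z u v w))))"
    by (subst sw_swap) simp
  also have "\<dots> = sw a (\<lambda>x a'. sw a' (\<lambda>y z. sw b (\<lambda>d w. sw d (\<lambda>u v. U x y z u v w))))"
    by (rule sw_coassoc[OF tri1])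
  also have "\<dots> = sw a (\<lambda>x a'. sw a' (\<lambda>y z. sw b (\<lambda>u b'. sw b' (\<lambda>v w. U x y z u v w))))"
    by (simp only: sw_coassoc[OF tri2])
  also have "\<dots> = sw a (\<lambda>x a'. sw a' (\<lambda>y z. f (?S (x * b) * (y * ?S z))))"
  proof -
    have 1: "sw b' (\<lambda>v w. U x y z u v w) = counit b' * f (?S (x * u) * (y * ?S z))" for x y z u b'
      using sw_antipode_right[of "\<lambda>m. f (?S (x * u) * y * m * ?S z)" b']
      by (simp add: form_simps U_def mult.assoc)
    have 2: "sw b (\<lambda>u b'. counit b' * f (?S (x * u) * (y * ?S z))) = f (?S (x * b) * (y * ?S z))" for x y z
      by (rule sw_counit_right) (simp add: form_simps)
    show ?thesis by (simp only: 1 2)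
  qed
  also have "\<dots> = sw a (\<lambda>x a'. counit a' * f (?S (x * b)))"
  proof -
    have "sw a' (\<lambda>y z. f (?S (x * b) * (y * ?S z))) = counit a' * f (?S (x * b) * 1)" for x a'
      by (rule sw_antipode_right) (simp add: form_simps)
    then show ?thesis by simp
  qed
  also have "\<dots> = f (?S (a * b))"
    by (rule sw_counit_right) (simp add: form_simps)
  finally show "f (?S (a * b)) = f (?S b * ?S a)" by simp
qed

lemma antipode_one: "antipode 1 = 1"
proof (rule forms_separate)
  fix f assume f: "lin f"
  have "sw 1 (\<lambda>x y. f (antipode x * y)) = f (antipode 1)"
    using f by (subst sw_one) (simp_all add: form_simps)
  then show "f (antipode 1) = f 1"
    using sw_antipode_left[OF f, of 1] by (simp add: counit_one)
qed

lemma counit_antipode: "counit (antipode a) = counit a"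
proof -
  have "counit (antipode a) = sw a (\<lambda>x y. counit y * counit (antipode x))"
    by (rule sw_counit_right[symmetric]) (rule linear_antipode[OF linear_counit])
  also have "\<dots> = sw a (\<lambda>x y. counit (antipode x * y))"
    by (simp add: counit_mult mult.commute)
  also have "\<dots> = counit a"
    by (simp add: sw_antipode_left[OF linear_counit] counit_one)
  finally show ?thesis .
qed

text \<open>
  The coproduct of \<open>S(a)\<close> is \<open>S(a\<^sub>2) \<otimes> S(a\<^sub>1)\<close>, since both are convolution inverses of the coproduct in
  \<open>Hom(H, H \<otimes> H)\<close>: here \<open>T x y z\<close> is the form of \<open>\<Delta>(S(x)) \<Delta>(y) (S(z\<^sub>2) \<otimes> S(z\<^sub>1))\<close>, which collapses from either side.
\<close>

lemma sw_antipode: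
  assumes B: "bilin B"
  shows "sw (antipode a) B = sw a (\<lambda>x y. B (antipode y) (antipode x))"
proof -
  let ?S = antipode
  note [simp] = bilinear_formD[OF B]
  \<comment> \<open>The product of the coproduct with its claimed inverse, that is, of \<open>y\<^sub>1 S(y\<^sub>4) \<otimes> y\<^sub>2 S(y\<^sub>3)\<close>.\<close>
  have collapse: "sw y (\<lambda>u v. sw u (\<lambda>u1 u2. sw v (\<lambda>s t. C (u1 * ?S t) (u2 * ?S s)))) = counit y * C 1 1"
    if C: "bilin C" for C y
  proof -
    note [simp] = bilinear_formD[OF C]
    have tri1: "trilin (\<lambda>u1 u2 v. sw v (\<lambda>s t. C (u1 * ?S t) (u2 * ?S s)))"
      by (simp add: form_simps)
    have tri2: "trilin (\<lambda>u2 s t. C (u1 * ?S t) (u2 * ?S s))" for u1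
      by (simp add: form_simps)
    have 1: "sw z (\<lambda>u2 s. C (u1 * ?S t) (u2 * ?S s)) = counit z * C (u1 * ?S t) 1" for u1 z t
      by (rule sw_antipode_right) (simp add: form_simps)
    have 2: "sw w (\<lambda>z t. counit z * C (u1 * ?S t) 1) = C (u1 * ?S w) 1" for u1 w
      by (rule sw_counit_left) (simp add: form_simps)
    have 3: "sw y (\<lambda>u1 w. C (u1 * ?S w) 1) = counit y * C 1 1"
      by (rule sw_antipode_right) (simp add: form_simps)
    show ?thesis
      by (simp only: sw_coassoc[OF tri1] sw_coassoc[OF tri2, symmetric] 1 2 3)
  qed
  define T where "T x y z = sw (?S x) (\<lambda>p r. sw y (\<lambda>u v. sw z (\<lambda>s t. B (p * u * ?S t) (r * v * ?S s))))" for x y z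
  have tri: "trilin T"
    unfolding T_def by (simp add: form_simps)
  have "sw a (\<lambda>x y. B (?S y) (?S x)) = sw a (\<lambda>c z. counit c * sw z (\<lambda>s t. B (?S t) (?S s)))"
    by (rule sw_counit_left[symmetric]) (simp add: form_simps)
  also have "\<dots> = sw a (\<lambda>c z. sw c (\<lambda>x y. T x y z))"
  proof -
    have "sw c (\<lambda>x y. T x y z) = sw c (\<lambda>x y. sw (?S x * y) (\<lambda>p r. sw z (\<lambda>s t. B (p * ?S t) (r * ?S s))))" for c z
      unfolding T_def by (subst sw_mult) (simp_all add: form_simps)
    also have "\<dots> c z = counit c * sw 1 (\<lambda>p r. sw z (\<lambda>s t. B (p * ?S t) (r * ?S s)))" for c z
      by (rule sw_antipode_left) (simp add: form_simps)
    also have "\<dots> c z = counit c * sw z (\<lambda>s t. B (?S t) (?S s))" for c z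
      by (subst sw_one) (simp_all add: form_simps)
    finally show ?thesis by simp
  qed
  also have "\<dots> = sw a (\<lambda>x a'. sw a' (\<lambda>y z. T x y z))"
    by (rule sw_coassoc[OF tri])
  also have "\<dots> = sw a (\<lambda>x a'. counit a' * sw (?S x) B)"
  proof -
    have "sw a' (\<lambda>y z. T x y z) = sw (?S x) (\<lambda>p r. counit a' * B p r)" for x a'
      unfolding T_def
      using collapse[of "\<lambda>m n. B (p * m) (r * n)" a' for p r]
      by (subst sw_swap) (simp add: form_simps mult.assoc)
    then show ?thesis by (simp add: sw_cmult)
  qed
  also have "\<dots> = sw (?S a) B"
    by (rule sw_counit_right) (simp add: form_simps)
  finally show ?thesis by simp
qed

end


section \<open>Hopf subalgebras\<close>

context hopf_algebra
begin

text \<open>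
  This expresses that the coproduct of \<open>a\<close> lies in the image of \<open>L \<otimes> L\<close>, by duality: every bilinear form that
  vanishes on \<open>L\<close> kills it. In this form the closure properties below are immediate from the rules for Sweedler sums.
\<close>

definition comul_within :: "'h set \<Rightarrow> 'h \<Rightarrow> bool"
  where "comul_within L a \<longleftrightarrow>
    (\<forall>B. bilin B \<longrightarrow> (\<forall>x\<in>L. \<forall>y\<in>L. B x y = 0) \<longrightarrow> sw a B = 0)"

lemma comul_within_iff:
  "comul_within L a \<longleftrightarrow>
    (\<exists>t. Poly_Mapping.keys t \<subseteq> L \<times> L \<and> tensor_eq scale scale (comul a) t)"
proof
  assume "comul_within L a"
  then show "\<exists>t. Poly_Mapping.keys t \<subseteq> L \<times> L \<and> tensor_eq scale scale (comul a) t"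
    by (intro tensor_supported_if_forms_vanish) (auto simp: comul_within_def sw_def)
next
  assume "\<exists>t. Poly_Mapping.keys t \<subseteq> L \<times> L \<and> tensor_eq scale scale (comul a) t"
  then obtain t where t: "Poly_Mapping.keys t \<subseteq> L \<times> L" "tensor_eq scale scale (comul a) t"
    by blast
  show "comul_within L a"
    unfolding comul_within_def
  proof (intro allI impI)
    fix B assume B: "bilin B" "\<forall>x\<in>L. \<forall>y\<in>L. B x y = 0"
    have "sw a B = ev2 B t" unfolding sw_def by (rule ev2_tensor_eq[OF B(1) t(2)])
    also have "\<dots> = ev2 (\<lambda>x y. 0) t" using t(1) B(2) by (intro ev2_cong) auto
    also have "\<dots> = 0" by (simp add: ev2_def lin_ext_def)
    finally show "sw a B = 0" .
  qed
qed

lemma sw_cong_within: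
  assumes "comul_within L a" "bilin B" "bilin C" "\<And>x y. x \<in> L \<Longrightarrow> y \<in> L \<Longrightarrow> B x y = C x y"
  shows "sw a B = sw a C"
proof -
  have "bilin (\<lambda>x y. B x y + (- 1) * C x y)"
    using assms(2,3) by (simp add: form_defs algebra_simps)
  moreover have "\<forall>x\<in>L. \<forall>y\<in>L. B x y + (- 1) * C x y = 0" using assms(4) by simp
  ultimately have "sw a (\<lambda>x y. B x y + (- 1) * C x y) = 0"
    using assms(1) unfolding comul_within_def by blast
  then show ?thesis unfolding sw_cadd sw_cmult by simp
qed

lemma comul_within_add: "comul_within L a \<Longrightarrow> comul_within L b \<Longrightarrow> comul_within L (a + b)"
  by (simp add: comul_within_def sw_add)

lemma comul_within_scale: "comul_within L a \<Longrightarrow> comul_within L (scale c a)"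
  by (simp add: comul_within_def sw_scale)

lemma comul_within_one: "1 \<in> L \<Longrightarrow> comul_within L 1"
  by (simp add: comul_within_def sw_one)

lemma comul_within_mult:
  assumes L: "\<And>x y. x \<in> L \<Longrightarrow> y \<in> L \<Longrightarrow> x * y \<in> L"
    and a: "comul_within L a" and b: "comul_within L b"
  shows "comul_within L (a * b)"
  unfolding comul_within_def
proof (intro allI impI)
  fix B assume B: "bilin B" "\<forall>x\<in>L. \<forall>y\<in>L. B x y = 0"
  note [simp] = bilinear_formD[OF B(1)]
  have "sw b (\<lambda>u v. B (x * u) (y * v)) = 0" if "x \<in> L" "y \<in> L" for x y
  proof -
    have "bilin (\<lambda>u v. B (x * u) (y * v))" by (simp add: form_simps)
    then show ?thesis using b that B(2) L unfolding comul_within_def by blast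
  qed
  moreover have "bilin (\<lambda>x y. sw b (\<lambda>u v. B (x * u) (y * v)))" by (simp add: form_simps)
  ultimately show "sw (a * b) B = 0"
    using a unfolding comul_within_def sw_mult[OF B(1)] by blast
qed

lemma comul_within_antipode:
  assumes L: "\<And>x. x \<in> L \<Longrightarrow> antipode x \<in> L" and a: "comul_within L a"
  shows "comul_within L (antipode a)"
  unfolding comul_within_def
proof (intro allI impI)
  fix B assume B: "bilin B" "\<forall>x\<in>L. \<forall>y\<in>L. B x y = 0"
  note [simp] = bilinear_formD[OF B(1)]
  have "bilin (\<lambda>x y. B (antipode y) (antipode x))" by (simp add: form_simps)
  then show "sw (antipode a) B = 0"
    using a L B(2) unfolding comul_within_def sw_antipode[OF B(1)] by blast
qed

inductive_set algebra_generated :: "'h set \<Rightarrow> 'h set" for G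
  where
    gen: "g \<in> G \<Longrightarrow> g \<in> algebra_generated G"
  | one: "1 \<in> algebra_generated G"
  | add: "a \<in> algebra_generated G \<Longrightarrow> b \<in> algebra_generated G \<Longrightarrow> a + b \<in> algebra_generated G"
  | scale: "a \<in> algebra_generated G \<Longrightarrow> scale c a \<in> algebra_generated G"
  | mult: "a \<in> algebra_generated G \<Longrightarrow> b \<in> algebra_generated G \<Longrightarrow> a * b \<in> algebra_generated G"

text \<open>
  The iterates of the antipode are needed because the antipode of a generator need not be a
  polynomial in the generators.
\<close>

definition antipode_orbit :: "'h set \<Rightarrow> 'h set"
  where "antipode_orbit E = (\<Union>n. (antipode ^^ n) ` E)"

lemma antipode_orbit_base: "x \<in> E \<Longrightarrow> x \<in> algebra_generated (antipode_orbit E)"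
proof (rule algebra_generated.gen)
  assume "x \<in> E"
  then have "(antipode ^^ 0) x \<in> antipode_orbit E" unfolding antipode_orbit_def by blast
  then show "x \<in> antipode_orbit E" by simp
qed

text \<open>
  Describing the Hopf subalgebra generated by \<open>E\<close> from inside makes properties of it provable by induction, and shows
  that the intersection of all Hopf subalgebras containing \<open>E\<close> is one itself. The algebra generated by the antipode orbit is
  closed under the antipode because the antipode reverses products, and it is a subcoalgebra because the coproduct
  is multiplicative and reversed by the antipode.
\<close>

proposition hopf_subalgebra_generated_by_antipode_orbit:
  assumes E: "\<And>x. x \<in> E \<Longrightarrow> comul_within (algebra_generated (antipode_orbit E)) x"
  defines "L \<equiv> algebra_generated (antipode_orbit E)"
  shows "hopf_subalgebra scale comul antipode L"
    and "hopf_subalgebra_generated scale comul antipode E = L"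
proof -
  have S: "antipode a \<in> L" if "a \<in> L" for a
    using that unfolding L_def
  proof induction
    case (gen g)
    then obtain n x where "g = (antipode ^^ n) x" "x \<in> E" by (auto simp: antipode_orbit_def)
    then have "antipode g = (antipode ^^ Suc n) x" "x \<in> E" by simp_all
    then show ?case unfolding antipode_orbit_def by (blast intro: algebra_generated.gen)
  qed (auto simp: antipode_one antipode_mult lin_simps intro: algebra_generated.intros)
  have orb: "comul_within L ((antipode ^^ n) x)" if "x \<in> E" for n x
    by (induction n) (use E that S in \<open>auto simp: L_def intro: comul_within_antipode\<close>)
  have comul: "comul_within L a" if "a \<in> L" for a
    using that[unfolded L_def]
  proof induction
    case (gen g)
    then show ?case using orb by (auto simp: antipode_orbit_def)
  qed (auto simp: L_def intro!: comul_within_one comul_within_add comul_within_scale comul_within_mult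
        intro: algebra_generated.intros)
  have "subspace L"
    using algebra_generated.scale[OF algebra_generated.one, of 0]
    by (auto simp: subspace_def L_def intro: algebra_generated.intros)
  then show hopf: "hopf_subalgebra scale comul antipode L"
    using S comul unfolding hopf_subalgebra_def comul_within_iff
    by (auto simp: L_def intro: algebra_generated.intros)
  have "E \<subseteq> L"
    unfolding L_def by (blast intro: antipode_orbit_base)
  moreover have "L \<subseteq> B" if B: "hopf_subalgebra scale comul antipode B" "E \<subseteq> B" for B
  proof
    fix a assume "a \<in> L"
    have cl: "1 \<in> B" "\<And>a b. a \<in> B \<Longrightarrow> b \<in> B \<Longrightarrow> a + b \<in> B" "\<And>c a. a \<in> B \<Longrightarrow> scale c a \<in> B"
        "\<And>a b. a \<in> B \<Longrightarrow> b \<in> B \<Longrightarrow> a * b \<in> B" "\<And>a. a \<in> B \<Longrightarrow> antipode a \<in> B"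
      using B(1) by (simp_all add: hopf_subalgebra_def subspace_add subspace_scale)
    have orbit: "(antipode ^^ n) x \<in> B" if "x \<in> E" for n x
      by (induction n) (use that B(2) cl(5) in auto)
    from \<open>a \<in> L\<close> show "a \<in> B"
      unfolding L_def
    proof induction
      case (gen g)
      then show ?case using orbit by (auto simp: antipode_orbit_def)
    qed (simp_all add: cl)
  qed
  ultimately show "hopf_subalgebra_generated scale comul antipode E = L"
    using hopf unfolding hopf_subalgebra_generated_def by blast
qed


section \<open>The group of algebra maps\<close>

text \<open>
  The convolution product chooses a representative of the coproduct inside \<open>K \<otimes> K\<close>. On such a representative the forms
  can be replaced by linear extensions to \<open>H\<close>, and then the value depends on the tensor only.
\<close>

lemma convolution_extension:
  assumes K: "hopf_subalgebra scale comul antipode K"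
    and f: "lin f'" "\<And>a. a \<in> K \<Longrightarrow> f' a = f a"
    and g: "lin g'" "\<And>a. a \<in> K \<Longrightarrow> g' a = g a"
    and a: "a \<in> K"
  shows "convolution scale comul K f g a = sw a (\<lambda>x y. f' x * g' y)"
proof -
  let ?P = "\<lambda>t. Poly_Mapping.keys t \<subseteq> K \<times> K \<and> tensor_eq scale scale (comul a) t"
  have "\<exists>t. ?P t" using K a by (simp add: hopf_subalgebra_def)
  then have t: "?P (SOME t. ?P t)" by (rule someI_ex)
  have "bilin (\<lambda>x y. f' x * g' y)" using f(1) g(1) by (simp add: form_defs algebra_simps)
  from ev2_tensor_eq[OF this] t
  have "sw a (\<lambda>x y. f' x * g' y) = ev2 (\<lambda>x y. f' x * g' y) (SOME t. ?P t)"
    unfolding sw_def by blast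
  also have "\<dots> = ev2 (\<lambda>x y. f x * g y) (SOME t. ?P t)"
    using t f(2) g(2) by (intro ev2_cong) auto
  finally show ?thesis using a by (simp add: convolution_def ev2_def)
qed

lemma alg_map_extension:
  assumes K: "hopf_subalgebra scale comul antipode K" and f: "f \<in> alg_maps scale K"
  obtains f' where "lin f'" "\<And>a. a \<in> K \<Longrightarrow> f' a = f a"
  using extend_linear_form[OF vector_space_axioms, of K f] K f
  by (auto simp: hopf_subalgebra_def alg_maps_def)

lemma convolution_alg_maps:
  assumes K: "hopf_subalgebra scale comul antipode K"
    and f: "f \<in> alg_maps scale K" and g: "g \<in> alg_maps scale K"
  shows "convolution scale comul K f g \<in> alg_maps scale K"
proof -
  obtain f' where f': "lin f'" "\<And>a. a \<in> K \<Longrightarrow> f' a = f a" using alg_map_extension[OF K f] by blast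
  obtain g' where g': "lin g'" "\<And>a. a \<in> K \<Longrightarrow> g' a = g a" using alg_map_extension[OF K g] by blast
  note [simp] = linear_form_add[OF f'(1)] linear_form_scale[OF f'(1)]
    linear_form_add[OF g'(1)] linear_form_scale[OF g'(1)]
  have conv: "convolution scale comul K f g a = sw a (\<lambda>x y. f' x * g' y)" if "a \<in> K" for a
    by (rule convolution_extension[OF K f' g' that])
  have bil: "bilin (\<lambda>x y. f' x * g' y)" by (simp add: form_simps)
  have K': "1 \<in> K" "\<And>a b. a \<in> K \<Longrightarrow> b \<in> K \<Longrightarrow> a + b \<in> K" "\<And>c a. a \<in> K \<Longrightarrow> scale c a \<in> K"
      "\<And>a b. a \<in> K \<Longrightarrow> b \<in> K \<Longrightarrow> a * b \<in> K"
    using K by (auto simp: hopf_subalgebra_def subspace_add subspace_scale)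
  have within: "comul_within K a" if "a \<in> K" for a
    using K that by (simp add: hopf_subalgebra_def comul_within_iff)
  have fm: "f' (x * u) = f' x * f' u" "g' (x * u) = g' x * g' u" if "x \<in> K" "u \<in> K" for x u
    using f g f'(2) g'(2) K' that by (simp_all add: alg_maps_def)
  have "sw (a * b) (\<lambda>x y. f' x * g' y) = sw a (\<lambda>x y. f' x * g' y) * sw b (\<lambda>x y. f' x * g' y)"
    if ab: "a \<in> K" "b \<in> K" for a b
  proof -
    have "sw b (\<lambda>u v. f' (x * u) * g' (y * v)) = f' x * g' y * sw b (\<lambda>u v. f' u * g' v)"
      if "x \<in> K" "y \<in> K" for x y
      unfolding sw_cmult[symmetric]
      by (rule sw_cong_within[OF within[OF ab(2)]]) (simp_all add: form_simps fm that)
    then have "sw a (\<lambda>x y. sw b (\<lambda>u v. f' (x * u) * g' (y * v))) =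
        sw a (\<lambda>x y. f' x * g' y * sw b (\<lambda>u v. f' u * g' v))"
      by (intro sw_cong_within[OF within[OF ab(1)]]) (simp_all add: form_simps mult.assoc)
    then show ?thesis by (simp add: sw_mult[OF bil] sw_mult_right)
  qed
  moreover have "f' 1 * g' 1 = 1" using f g f'(2) g'(2) K' by (simp add: alg_maps_def)
  ultimately show ?thesis
    by (simp add: alg_maps_def conv K' sw_add[OF bil] sw_scale[OF bil] sw_one[OF bil])
      (simp add: convolution_def)
qed

text \<open>
  The inverse of an algebra map \<open>f\<close> is \<open>f \<circ> S\<close>; it is multiplicative because the antipode reverses products and
  the field is commutative.
\<close>

theorem group_Alg:
  assumes K: "hopf_subalgebra scale comul antipode K"
  shows "group (Alg scale comul counit K)"
proof -
  have K': "1 \<in> K" "\<And>a b. a \<in> K \<Longrightarrow> b \<in> K \<Longrightarrow> a + b \<in> K" "\<And>c a. a \<in> K \<Longrightarrow> scale c a \<in> K"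
      "\<And>a b. a \<in> K \<Longrightarrow> b \<in> K \<Longrightarrow> a * b \<in> K" "\<And>a. a \<in> K \<Longrightarrow> antipode a \<in> K"
    using K by (auto simp: hopf_subalgebra_def subspace_add subspace_scale)
  have within: "comul_within K a" if "a \<in> K" for a
    using K that by (simp add: hopf_subalgebra_def comul_within_iff)
  let ?conv = "convolution scale comul K" and ?M = "alg_maps scale K"
  have ext: "f = g" if "f \<in> ?M" "g \<in> ?M" "\<And>a. a \<in> K \<Longrightarrow> f a = g a" for f g
    using that by (auto simp: alg_maps_def intro: extensionalityI)
  have one: "restrict counit K \<in> ?M"
    using K' by (simp add: alg_maps_def lin_simps counit_mult counit_one)
  show ?thesis
  proof (rule groupI, unfold Alg_def, simp_all)
    show "?conv f g \<in> ?M" if "f \<in> ?M" "g \<in> ?M" for f g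
      using convolution_alg_maps[OF K that] .
  next
    show "restrict counit K \<in> ?M" by (rule one)
  next
    fix f g h assume M: "f \<in> ?M" "g \<in> ?M" "h \<in> ?M"
    obtain f' where f': "lin f'" "\<And>a. a \<in> K \<Longrightarrow> f' a = f a" using alg_map_extension[OF K M(1)] by blast
    obtain g' where g': "lin g'" "\<And>a. a \<in> K \<Longrightarrow> g' a = g a" using alg_map_extension[OF K M(2)] by blast
    obtain h' where h': "lin h'" "\<And>a. a \<in> K \<Longrightarrow> h' a = h a" using alg_map_extension[OF K M(3)] by blast
    note [simp] = linear_form_add[OF f'(1)] linear_form_scale[OF f'(1)]
      linear_form_add[OF g'(1)] linear_form_scale[OF g'(1)]
      linear_form_add[OF h'(1)] linear_form_scale[OF h'(1)]
    let ?fg = "\<lambda>a. sw a (\<lambda>x y. f' x * g' y)" and ?gh = "\<lambda>a. sw a (\<lambda>x y. g' x * h' y)"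
    have fg: "lin ?fg" and gh: "lin ?gh" by (simp_all add: form_simps)
    have fgK: "?fg a = ?conv f g a" and ghK: "?gh a = ?conv g h a" if "a \<in> K" for a
      using convolution_extension[OF K f' g' that] convolution_extension[OF K g' h' that] by simp_all
    show "?conv (?conv f g) h = ?conv f (?conv g h)"
    proof (rule ext)
      fix a assume a: "a \<in> K"
      have tri: "trilin (\<lambda>x y z. f' x * (g' y * h' z))" by (simp add: form_simps mult.assoc)
      have "?conv (?conv f g) h a = sw a (\<lambda>x z. ?fg x * h' z)"
        by (rule convolution_extension[OF K fg fgK h' a])
      also have "\<dots> = sw a (\<lambda>x z. sw x (\<lambda>u v. f' u * (g' v * h' z)))"
        by (simp add: sw_mult_right[symmetric] mult.assoc)
      also have "\<dots> = sw a (\<lambda>x y. f' x * ?gh y)"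
        by (simp add: sw_coassoc[OF tri] sw_cmult)
      also have "\<dots> = ?conv f (?conv g h) a"
        by (rule convolution_extension[OF K f' gh ghK a, symmetric])
      finally show "?conv (?conv f g) h a = ?conv f (?conv g h) a" .
    qed (intro convolution_alg_maps[OF K] M)+
  next
    fix f assume f: "f \<in> ?M"
    obtain f' where f': "lin f'" "\<And>a. a \<in> K \<Longrightarrow> f' a = f a" using alg_map_extension[OF K f] by blast
    note [simp] = linear_form_add[OF f'(1)] linear_form_scale[OF f'(1)]
    show "?conv (restrict counit K) f = f"
    proof (rule ext)
      fix a assume a: "a \<in> K"
      show "?conv (restrict counit K) f a = f a"
        using convolution_extension[OF K linear_counit _ f' a, of "restrict counit K"]
        by (simp add: sw_counit_left[OF f'(1)] f'(2)[OF a])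
    qed (intro convolution_alg_maps[OF K] one f)+
    show "\<exists>g\<in>?M. ?conv g f = restrict counit K"
    proof
      let ?g = "\<lambda>a\<in>K. f (antipode a)"
      show g: "?g \<in> ?M"
        using f K' by (simp add: alg_maps_def lin_simps antipode_mult antipode_one mult.commute)
      show "?conv ?g f = restrict counit K"
      proof (rule ext)
        fix a assume a: "a \<in> K"
        have "?conv ?g f a = sw a (\<lambda>x y. f' (antipode x) * f' y)"
          by (rule convolution_extension[OF K _ _ f' a]) (simp_all add: form_simps K' f')
        also have "\<dots> = sw a (\<lambda>x y. f' (antipode x * y))"
          using f f'(2) K'
          by (intro sw_cong_within[OF within[OF a]]) (simp_all add: form_simps alg_maps_def)
        also have "\<dots> = counit a"
          using f f'(2) K' by (simp add: sw_antipode_left[OF f'(1)] alg_maps_def)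
        finally show "?conv ?g f a = restrict counit K a" using a by simp
      qed (intro convolution_alg_maps[OF K] one f g)+
    qed
  qed
qed

end


section \<open>Forms on Yetter-Drinfeld modules\<close>

context yetter_drinfeld
begin

text \<open>
  \<open>cv v C\<close> is the analogue of a Sweedler sum for the coaction: the sum of \<open>C v\<^sub>-\<^sub>1 v\<^sub>0\<close>.
\<close>

definition cv :: "'v \<Rightarrow> ('h \<Rightarrow> 'v \<Rightarrow> 'k) \<Rightarrow> 'k"
  where "cv v C = ev2 C (coact v)"

abbreviation "biform \<equiv> bilinear_form scale scaleV"

lemma cv_cadd: "cv v (\<lambda>x y. B x y + C x y) = cv v B + cv v C"
  and cv_cmult: "cv v (\<lambda>x y. c * B x y) = c * cv v B"
  and cv_mult_right: "cv v (\<lambda>x y. B x y * c) = cv v B * c"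
  by (simp_all add: cv_def ev2_add ev2_cmult ev2_mult_right)

lemma cv_sw_swap: "cv v (\<lambda>m u. sw a (\<lambda>x y. F m u x y)) = sw a (\<lambda>x y. cv v (\<lambda>m u. F m u x y))"
  unfolding cv_def sw_def by (rule ev2_swap)

lemma act_simps:
  "act (a + b) v = act a v + act b v" "act (scale c a) v = scaleV c (act a v)"
  "act a (v + w) = act a v + act a w" "act a (scaleV c v) = scaleV c (act a v)"
  using act_linear by (auto simp: act_add_left act_scale_left Vector_Spaces.linear_iff)

lemma cv_add: "biform C \<Longrightarrow> cv (v + w) C = cv v C + cv w C"
  unfolding cv_def using ev2_tensor_eq[OF _ coact_add] by (simp add: linear_form_add[OF linear_form_ev2])

lemma cv_scale: "biform C \<Longrightarrow> cv (scaleV c v) C = c * cv v C"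
  unfolding cv_def using ev2_tensor_eq[OF _ coact_scale] by (simp add: linear_form_scale[OF linear_form_ev2])

lemma cv_coassoc:
  "trilinear_form scale scale scaleV T \<Longrightarrow>
    cv v (\<lambda>x u. sw x (\<lambda>y z. T y z u)) = cv v (\<lambda>x u. cv u (\<lambda>y u'. T x y u'))"
  unfolding cv_def sw_def using ev3_tensor3_eq[OF _ coact_coassoc]
  by (simp add: ev2_def ev3_def lin_ext_lin_ext case_prod_unfold)

lemma cv_counit: "linear_form scaleV f \<Longrightarrow> cv v (\<lambda>x u. counit x * f u) = f v"
  using linear_form_of_lin_ext[of scaleV f "\<lambda>(x, u). scaleV (counit x) u" "coact v"]
  unfolding cv_def coact_counit by (simp add: ev2_def case_prod_unfold linear_form_scale)

lemma cv_act:
  "biform C \<Longrightarrow> cv (act h v) C =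
    sw h (\<lambda>h1 h'. sw h' (\<lambda>h2 h3. cv v (\<lambda>m u. C (h1 * m * antipode h3) (act h2 u))))"
  unfolding cv_def sw_def using ev2_tensor_eq[OF _ compatibility]
  by (simp add: ev2_def lin_ext_lin_ext case_prod_unfold)

lemmas yd_simps = form_simps cv_cadd cv_cmult cv_mult_right cv_add cv_scale act_simps

text \<open>
  The categorical braiding \<open>v \<otimes> w \<mapsto> v\<^sub>-\<^sub>1 w \<otimes> v\<^sub>0\<close> is a morphism of \<open>H\<close>-modules. By the compatibility axiom
  \<open>a (v \<otimes> w)\<close> is sent to \<open>a\<^sub>1 v\<^sub>-\<^sub>1 S(a\<^sub>3) a\<^sub>4 w \<otimes> a\<^sub>2 v\<^sub>0\<close>, where \<open>S(a\<^sub>3) a\<^sub>4\<close> cancels.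
  The form \<open>D\<close> on the tensor square serves to compare the two sides.
\<close>

proposition braiding_H_linear:
  assumes D: "bilinear_form scaleV scaleV D"
  shows "sw a (\<lambda>x y. cv (act x v) (\<lambda>m u. D (act m (act y w)) u)) =
    cv v (\<lambda>m u. sw a (\<lambda>x y. D (act x (act m w)) (act y u)))"
proof -
  note [simp] = bilinear_formD[OF D]
  let ?S = antipode
  define U where "U h1 h2 h3 y = cv v (\<lambda>m u. D (act (h1 * m * ?S h3 * y) w) (act h2 u))" for h1 h2 h3 y
  have tri1: "trilin (\<lambda>h1 h' y. sw h' (\<lambda>h2 h3. U h1 h2 h3 y))"
    unfolding U_def by (simp add: yd_simps)
  have tri2: "trilin (\<lambda>h2 h3 y. U h1 h2 h3 y)" for h1
    unfolding U_def by (simp add: yd_simps)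
  have "cv (act x v) (\<lambda>m u. D (act m (act y w)) u) = sw x (\<lambda>h1 h'. sw h' (\<lambda>h2 h3. U h1 h2 h3 y))" for x y
    unfolding U_def by (subst cv_act) (simp_all add: yd_simps act_mult)
  then have "sw a (\<lambda>x y. cv (act x v) (\<lambda>m u. D (act m (act y w)) u)) =
      sw a (\<lambda>h1 b. sw b (\<lambda>h' y. sw h' (\<lambda>h2 h3. U h1 h2 h3 y)))"
    by (simp add: sw_coassoc[OF tri1])
  also have "\<dots> = sw a (\<lambda>h1 b. sw b (\<lambda>h2 c. sw c (\<lambda>h3 y. U h1 h2 h3 y)))"
    by (simp add: sw_coassoc[OF tri2])
  also have "\<dots> = sw a (\<lambda>h1 b. sw b (\<lambda>h2 c. counit c * cv v (\<lambda>m u. D (act (h1 * m) w) (act h2 u))))"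
  proof -
    have "sw c (\<lambda>h3 y. U h1 h2 h3 y) = counit c * cv v (\<lambda>m u. D (act (h1 * m) w) (act h2 u))" for h1 h2 c
      using sw_antipode_left[of "\<lambda>p. cv v (\<lambda>m u. D (act (h1 * m * p) w) (act h2 u))" c]
      by (simp add: yd_simps U_def mult.assoc)
    then show ?thesis by simp
  qed
  also have "\<dots> = sw a (\<lambda>h1 b. cv v (\<lambda>m u. D (act (h1 * m) w) (act b u)))"
  proof -
    have "sw b (\<lambda>h2 c. counit c * cv v (\<lambda>m u. D (act (h1 * m) w) (act h2 u))) =
        cv v (\<lambda>m u. D (act (h1 * m) w) (act b u))" for h1 b
      by (rule sw_counit_right) (simp add: yd_simps)
    then show ?thesis by simp
  qed
  finally show ?thesis by (simp add: cv_sw_swap act_mult)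
qed

end


section \<open>Coefficient matrices\<close>

context hopf_algebra
begin

text \<open>
  \<open>A\<close> is a matrix of coefficients of a comodule: \<open>\<Delta>(A\<^sub>x\<^sub>y) = \<Sum>\<^sub>k A\<^sub>x\<^sub>k \<otimes> A\<^sub>k\<^sub>y\<close>, with finite rows. The
  antipode exchanges the tensor factors and preserves the finiteness of rows, not of columns; hence the matrix
  of its values need not become a comatrix by transposition, and a separate notion is used for it.
\<close>

definition comatrix :: "('x \<Rightarrow> 'x \<Rightarrow> 'h) \<Rightarrow> bool"
  where "comatrix A \<longleftrightarrow> (\<forall>x y. counit (A x y) = (if x = y then 1 else 0)) \<and>
    (\<forall>x. \<exists>F. finite F \<and> (\<forall>k. k \<notin> F \<longrightarrow> A x k = 0) \<and>
      (\<forall>y B. bilin B \<longrightarrow> sw (A x y) B = (\<Sum>k\<in>F. B (A x k) (A k y))))"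

definition anticomatrix :: "('x \<Rightarrow> 'x \<Rightarrow> 'h) \<Rightarrow> bool"
  where "anticomatrix A \<longleftrightarrow> (\<forall>x y. counit (A x y) = (if x = y then 1 else 0)) \<and>
    (\<forall>x. \<exists>F. finite F \<and> (\<forall>k. k \<notin> F \<longrightarrow> A x k = 0) \<and>
      (\<forall>y B. bilin B \<longrightarrow> sw (A x y) B = (\<Sum>k\<in>F. B (A k y) (A x k))))"

lemma antipode_zero: "antipode 0 = 0"
  using lin_simps(2)[of 0 0] by simp

lemma anticomatrix_antipode:
  assumes "comatrix A"
  shows "anticomatrix (\<lambda>x y. antipode (A x y))"
  unfolding anticomatrix_def
proof (intro conjI allI)
  fix x
  obtain F where F: "finite F" "\<And>k. k \<notin> F \<Longrightarrow> A x k = 0"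
      "\<And>y B. bilin B \<Longrightarrow> sw (A x y) B = (\<Sum>k\<in>F. B (A x k) (A k y))"
    using assms unfolding comatrix_def by blast
  have "sw (antipode (A x y)) B = (\<Sum>k\<in>F. B (antipode (A k y)) (antipode (A x k)))"
    if B: "bilin B" for y B
  proof -
    have "bilin (\<lambda>x y. B (antipode y) (antipode x))"
      using bilinear_formD[OF B] by (simp add: form_simps)
    then show ?thesis by (simp add: sw_antipode[OF B] F(3))
  qed
  then show "\<exists>F. finite F \<and> (\<forall>k. k \<notin> F \<longrightarrow> antipode (A x k) = 0) \<and> (\<forall>y B. bilin B \<longrightarrow>
      sw (antipode (A x y)) B = (\<Sum>k\<in>F. B (antipode (A k y)) (antipode (A x k))))"
    using F(1,2) antipode_zero by metis
qed (use assms in \<open>simp add: comatrix_def counit_antipode\<close>)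

lemma comatrix_antipode:
  assumes "anticomatrix A"
  shows "comatrix (\<lambda>x y. antipode (A x y))"
  unfolding comatrix_def
proof (intro conjI allI)
  fix x
  obtain F where F: "finite F" "\<And>k. k \<notin> F \<Longrightarrow> A x k = 0"
      "\<And>y B. bilin B \<Longrightarrow> sw (A x y) B = (\<Sum>k\<in>F. B (A k y) (A x k))"
    using assms unfolding anticomatrix_def by blast
  have "sw (antipode (A x y)) B = (\<Sum>k\<in>F. B (antipode (A x k)) (antipode (A k y)))"
    if B: "bilin B" for y B
  proof -
    have "bilin (\<lambda>x y. B (antipode y) (antipode x))"
      using bilinear_formD[OF B] by (simp add: form_simps)
    then show ?thesis by (simp add: sw_antipode[OF B] F(3))
  qed
  then show "\<exists>F. finite F \<and> (\<forall>k. k \<notin> F \<longrightarrow> antipode (A x k) = 0) \<and> (\<forall>y B. bilin B \<longrightarrow>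
      sw (antipode (A x y)) B = (\<Sum>k\<in>F. B (antipode (A x k)) (antipode (A k y))))"
    using F(1,2) antipode_zero by metis
qed (use assms in \<open>simp add: anticomatrix_def counit_antipode\<close>)

end

lemma sum_single:
  assumes "finite F" "\<And>k. k \<noteq> u \<Longrightarrow> g k = 0" "u \<notin> F \<Longrightarrow> g u = 0"
  shows "sum g F = g u"
proof -
  have "sum g F = (\<Sum>k\<in>F. if k = u then g u else 0)"
    by (intro sum.cong) (auto simp: assms(2))
  then show ?thesis using assms(1,3) by auto
qed

context yetter_drinfeld
begin

lemma act_zero [simp]: "act 0 v = 0" "act a 0 = 0"
  using act_simps(2)[of 0 0 v] act_simps(4)[of a 0 0] by simp_all

lemma forms_separate_vectors: "(\<And>f. linear_form scaleV f \<Longrightarrow> f v = f w) \<Longrightarrow> v = w"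
  by (rule linear_forms_separate[OF V.vector_space_axioms])

text \<open>
  The matrix \<open>S(A)\<close> is inverse to \<open>A\<close>. If the entries of \<open>A\<close> act on the line of \<open>w\<close> by a monomial matrix, the sum
  expressing this has at most one nonzero term, which determines the action of the entries of \<open>S(A)\<close>.
\<close>

lemma antipode_of_comatrix_acts_monomially:
  assumes A: "comatrix A" and \<rho>: "inj \<rho>" and \<alpha>: "\<And>x. \<alpha> x \<noteq> 0"
    and act: "\<And>x y. act (A x y) w = (if \<rho> x = y then scaleV (\<alpha> x) w else 0)"
  shows "act (antipode (A x y)) w = (if x = \<rho> y then scaleV (inverse (\<alpha> y)) w else 0)"
proof (rule forms_separate_vectors)
  fix f assume f: "linear_form scaleV f"
  note [simp] = linear_form_add[OF f] linear_form_scale[OF f] linear_form_zero[OF f]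
  obtain F where F: "finite F" "\<And>k. k \<notin> F \<Longrightarrow> A x k = 0"
      "\<And>y B. bilin B \<Longrightarrow> sw (A x y) B = (\<Sum>k\<in>F. B (A x k) (A k y))"
    using A unfolding comatrix_def by blast
  let ?g = "\<lambda>p. f (act p w)"
  have g: "lin ?g" by (simp add: linear_form_def act_simps)
  let ?h = "\<lambda>k. ?g (antipode (A x k) * A k (\<rho> y))"
  have "sum ?h F = ?h y"
    by (rule sum_single[OF F(1)]) (use \<rho> F(2) in \<open>auto simp: act_mult act antipode_zero inj_eq\<close>)
  moreover have "?h y = \<alpha> y * ?g (antipode (A x y))"
    by (simp add: act_mult act act_simps)
  moreover have "sum ?h F = counit (A x (\<rho> y)) * ?g 1"
  proof -
    have "bilin (\<lambda>p r. ?g (antipode p * r))" by (simp add: yd_simps)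
    from F(3)[OF this] show ?thesis by (simp add: sw_antipode_left[OF g])
  qed
  ultimately have "\<alpha> y * ?g (antipode (A x y)) = (if x = \<rho> y then f w else 0)"
    using A by (auto simp: comatrix_def act_one split: if_splits)
  then have "?g (antipode (A x y)) = inverse (\<alpha> y) * (if x = \<rho> y then f w else 0)"
    using \<alpha>[of y] by (simp add: field_simps)
  then show "f (act (antipode (A x y)) w) = f (if x = \<rho> y then scaleV (inverse (\<alpha> y)) w else 0)"
    by simp
qed

lemma antipode_of_anticomatrix_acts_monomially:
  assumes A: "anticomatrix A" and \<rho>: "inj \<rho>" and \<beta>: "\<And>x. \<beta> x \<noteq> 0"
    and act: "\<And>x y. act (A x y) w = (if x = \<rho> y then scaleV (\<beta> y) w else 0)"
  shows "act (antipode (A x y)) w = (if \<rho> x = y then scaleV (inverse (\<beta> x)) w else 0)"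
proof (rule forms_separate_vectors)
  fix f assume f: "linear_form scaleV f"
  note [simp] = linear_form_add[OF f] linear_form_scale[OF f] linear_form_zero[OF f]
  obtain F where F: "finite F" "\<And>k. k \<notin> F \<Longrightarrow> A (\<rho> x) k = 0"
      "\<And>y B. bilin B \<Longrightarrow> sw (A (\<rho> x) y) B = (\<Sum>k\<in>F. B (A k y) (A (\<rho> x) k))"
    using A unfolding anticomatrix_def by blast
  let ?g = "\<lambda>p. f (act p w)"
  have g: "lin ?g" by (simp add: linear_form_def act_simps)
  let ?h = "\<lambda>k. ?g (antipode (A k y) * A (\<rho> x) k)"
  have "sum ?h F = ?h x"
    by (rule sum_single[OF F(1)]) (use \<rho> F(2) in \<open>auto simp: act_mult act inj_eq\<close>)
  moreover have "?h x = \<beta> x * ?g (antipode (A x y))"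
    by (simp add: act_mult act act_simps)
  moreover have "sum ?h F = counit (A (\<rho> x) y) * ?g 1"
  proof -
    have "bilin (\<lambda>p r. ?g (antipode p * r))" by (simp add: yd_simps)
    from F(3)[OF this] show ?thesis by (simp add: sw_antipode_left[OF g])
  qed
  ultimately have "\<beta> x * ?g (antipode (A x y)) = (if \<rho> x = y then f w else 0)"
    using A by (auto simp: anticomatrix_def act_one split: if_splits)
  then have "?g (antipode (A x y)) = inverse (\<beta> x) * (if \<rho> x = y then f w else 0)"
    using \<beta>[of x] by (simp add: field_simps)
  then show "f (act (antipode (A x y)) w) = f (if \<rho> x = y then scaleV (inverse (\<beta> x)) w else 0)"
    by simp
qed

text \<open>
  By the two preceding lemmas, even iterates of the antipode act on the line as the original entries do, and odd ones by
  the inverse monomial matrix.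
\<close>

lemma antipode_orbit_acts_diagonally:
  assumes A: "comatrix A" and \<rho>: "inj \<rho>" and \<alpha>: "\<And>x. \<alpha> x \<noteq> 0"
    and act: "\<And>x y. act (A x y) w = (if \<rho> x = y then scaleV (\<alpha> x) w else 0)"
  shows "\<exists>c. act ((antipode ^^ n) (A x y)) w = scaleV c w"
proof -
  have even: "comatrix (\<lambda>x y. (antipode ^^ (2 * m)) (A x y)) \<and>
    (\<forall>x y. act ((antipode ^^ (2 * m)) (A x y)) w = (if \<rho> x = y then scaleV (\<alpha> x) w else 0))" for m
  proof (induction m)
    case 0
    then show ?case using A act by simp
  next
    case (Suc m)
    let ?B = "\<lambda>x y. (antipode ^^ (2 * m)) (A x y)"
    have B: "comatrix ?B" using Suc by blast
    have 1: "act (antipode (?B x y)) w = (if x = \<rho> y then scaleV (inverse (\<alpha> y)) w else 0)" for x y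
      using Suc by (intro antipode_of_comatrix_acts_monomially[OF B \<rho> \<alpha>]) blast
    have 2: "act (antipode (antipode (?B x y))) w = (if \<rho> x = y then scaleV (inverse (inverse (\<alpha> x))) w else 0)" for x y
      by (rule antipode_of_anticomatrix_acts_monomially[OF anticomatrix_antipode[OF B] \<rho> _ 1]) (simp add: \<alpha>)
    show ?case
      using comatrix_antipode[OF anticomatrix_antipode[OF B]] 2 by simp
  qed
  have "n = 2 * (n div 2) \<or> n = Suc (2 * (n div 2))" by presburger
  then obtain m where "n = 2 * m \<or> n = Suc (2 * m)" by blast
  then show ?thesis
  proof
    assume "n = 2 * m"
    with even[of m] show ?thesis by (intro exI[of _ "if \<rho> x = y then \<alpha> x else 0"]) simp
  next
    assume n: "n = Suc (2 * m)"
    have "act (antipode ((antipode ^^ (2 * m)) (A x y))) w =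
        (if x = \<rho> y then scaleV (inverse (\<alpha> y)) w else 0)"
      using even[of m] by (intro antipode_of_comatrix_acts_monomially[OF _ \<rho> \<alpha>]) blast+
    then show ?thesis
      unfolding n by (intro exI[of _ "if x = \<rho> y then inverse (\<alpha> y) else 0"]) simp
  qed
qed

end


section \<open>Independence of characters\<close>

text \<open>
  Dedekind's argument: multiplying a relation by the value of one member at a suitable \<open>b\<close> and subtracting the relation translated
  by \<open>b\<close> eliminates that member, and the shorter relation is trivial by induction.
\<close>

lemma independent_multiplicative_family:
  fixes f :: "'x \<Rightarrow> 'h::monoid_mult \<Rightarrow> 'k::field"
  assumes mult: "\<And>x a b. a \<in> K \<Longrightarrow> b \<in> K \<Longrightarrow> f x (a * b) = f x a * f x b"
    and closed: "\<And>a b. a \<in> K \<Longrightarrow> b \<in> K \<Longrightarrow> a * b \<in> K"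
    and one: "1 \<in> K" "\<And>x. f x 1 = 1"
    and distinct: "\<And>x y. x \<noteq> y \<Longrightarrow> \<exists>a\<in>K. f x a \<noteq> f y a"
  shows "independent_family_on K f"
  unfolding independent_family_on_def
proof (intro allI impI)
  fix F :: "'x set" and c :: "'x \<Rightarrow> 'k"
  assume "finite F" and "\<forall>a\<in>K. (\<Sum>x\<in>F. c x * f x a) = 0"
  then show "\<forall>x\<in>F. c x = 0"
  proof (induction F arbitrary: c)
    case empty
    then show ?case by simp
  next
    case (insert y F)
    have c0: "c x = 0" if "x \<in> F" for x
    proof -
      from insert.hyps(2) that have "x \<noteq> y" by blast
      then obtain b where b: "b \<in> K" "f x b \<noteq> f y b" using distinct by blast
      have "(\<Sum>x\<in>F. (c x * (f x b - f y b)) * f x a) = 0" if a: "a \<in> K" for a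
      proof -
        have 1: "c y * f y (b * a) + (\<Sum>x\<in>F. c x * f x (b * a)) = 0"
          and 2: "c y * f y a + (\<Sum>x\<in>F. c x * f x a) = 0"
          using insert.prems insert.hyps a b closed by (metis sum.insert)+
        have "(\<Sum>x\<in>F. (c x * (f x b - f y b)) * f x a) =
            (\<Sum>x\<in>F. c x * f x (b * a)) - f y b * (\<Sum>x\<in>F. c x * f x a)"
          by (simp add: mult[OF b(1) a] sum_distrib_left sum_subtractf[symmetric] algebra_simps)
        also have "\<dots> = - (c y * f y (b * a)) - f y b * (- (c y * f y a))"
          using 1 2 by (simp only: add_eq_0_iff)
        also have "\<dots> = 0" by (simp add: mult[OF b(1) a])
        finally show ?thesis .
      qed
      then have "c x * (f x b - f y b) = 0"
        using insert.IH[of "\<lambda>x. c x * (f x b - f y b)"] that by blast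
      then show ?thesis using b(2) by simp
    qed
    then have "c y * f y 1 = 0" using insert.prems insert.hyps one(1) by auto
    then show ?case using c0 one(2) by simp
  qed
qed


section \<open>The enveloping group\<close>

lemma word_class_eq_iff: "word_class rop u = word_class rop v \<longleftrightarrow> rack_word_eq rop u v"
  unfolding word_class_def by (blast intro: rack_word_eq.intros)

lemma rack_word_eq_append:
  assumes "rack_word_eq rop u u'" "rack_word_eq rop v v'"
  shows "rack_word_eq rop (u @ v) (u' @ v')"
  using rack_word_eq.cong[OF assms(1), of "[]" v] rack_word_eq.cong[OF assms(2), of u' "[]"]
  by (auto intro: rack_word_eq.trans)

lemma carrier_enveloping_group: "carrier (enveloping_group rop) = range (word_class rop)"
  and one_enveloping_group: "\<one>\<^bsub>enveloping_group rop\<^esub> = word_class rop []"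
  by (simp_all add: enveloping_group_def)

lemma mult_enveloping_group:
  "word_class rop u \<otimes>\<^bsub>enveloping_group rop\<^esub> word_class rop v = word_class rop (u @ v)"
proof -
  have *: "word_class rop (u' @ v') = word_class rop (u @ v)"
    if "u' \<in> word_class rop u" "v' \<in> word_class rop v" for u' v'
    using that rack_word_eq_append[of rop u u' v v'] unfolding word_class_eq_iff
    by (auto simp: word_class_def intro: rack_word_eq.sym)
  have "u \<in> word_class rop u" "v \<in> word_class rop v"
    by (simp_all add: word_class_def rack_word_eq.refl)
  then have "word_class rop u \<noteq> {}" "word_class rop v \<noteq> {}" by blast+
  then show ?thesis by (simp add: enveloping_group_def * cong: SUP_cong_simp)
qed

definition inverse_word :: "('x \<times> bool) list \<Rightarrow> ('x \<times> bool) list"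
  where "inverse_word u = rev (map (\<lambda>(x, s). (x, \<not> s)) u)"

lemma inverse_word_cancel: "rack_word_eq rop (inverse_word u @ u) []"
proof (induction u)
  case Nil
  then show ?case by (simp add: inverse_word_def rack_word_eq.refl)
next
  case (Cons p u)
  obtain x s where p: "p = (x, s)" by (cases p)
  have "rack_word_eq rop (inverse_word u @ [(x, \<not> s), (x, \<not> \<not> s)] @ u) (inverse_word u @ [] @ u)"
    by (intro rack_word_eq.cong rack_word_eq.cancel)
  with Cons show ?case by (auto simp: inverse_word_def p intro: rack_word_eq.trans)
qed

lemma group_enveloping_group: "group (enveloping_group rop)"
proof (rule groupI)
  fix A assume "A \<in> carrier (enveloping_group rop)"
  then obtain u where u: "A = word_class rop u" by (auto simp: carrier_enveloping_group)
  have "word_class rop (inverse_word u) \<otimes>\<^bsub>enveloping_group rop\<^esub> A = \<one>\<^bsub>enveloping_group rop\<^esub>"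
    by (simp add: u mult_enveloping_group one_enveloping_group word_class_eq_iff inverse_word_cancel)
  then show "\<exists>B\<in>carrier (enveloping_group rop). B \<otimes>\<^bsub>enveloping_group rop\<^esub> A = \<one>\<^bsub>enveloping_group rop\<^esub>"
    by (auto simp: carrier_enveloping_group)
qed (auto simp: carrier_enveloping_group one_enveloping_group mult_enveloping_group)

lemma group_opposite_group:
  fixes G (structure)
  assumes "group G"
  shows "group (opposite_group G)"
proof -
  interpret group G by fact
  show ?thesis
  proof (rule groupI)
    fix x assume "x \<in> carrier (opposite_group G)"
    then show "\<exists>y\<in>carrier (opposite_group G). y \<otimes>\<^bsub>opposite_group G\<^esub> x = \<one>\<^bsub>opposite_group G\<^esub>"
      by (intro bexI[of _ "inv x"]) (simp_all add: opposite_group_def)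
  qed (simp_all add: opposite_group_def m_assoc)
qed

text \<open>
  The value of a word is computed letter by letter, in reverse order because of the opposite group.
  It respects free cancellation in any group, and the defining relation \<open>f\<^sub>x f\<^sub>y = f\<^bsub>x\<rhd>y\<^esub> f\<^sub>x\<close> turns into the hypothesis on \<open>g\<close>.
  Uniqueness holds since the letters generate the group.
\<close>

proposition enveloping_group_universal:
  fixes G :: "'g monoid" (structure) and g :: "'x \<Rightarrow> 'g"
  assumes "group G" and g: "\<And>x. g x \<in> carrier G"
    and rel: "\<And>x y. g y \<otimes>\<^bsub>G\<^esub> g x = g x \<otimes>\<^bsub>G\<^esub> g (rop x y)"
  shows "\<exists>!h. h \<in> extensional (carrier (enveloping_group rop)) \<and>
    group_hom (opposite_group (enveloping_group rop)) G h \<and> (\<forall>x. h (env_gen rop x) = g x)"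
proof -
  interpret group G by fact
  let ?X = "enveloping_group rop"
  interpret Op: group "opposite_group ?X"
    by (rule group_opposite_group[OF group_enveloping_group])
  have op: "carrier (opposite_group ?X) = range (word_class rop)"
      "word_class rop u \<otimes>\<^bsub>opposite_group ?X\<^esub> word_class rop v = word_class rop (v @ u)"
      "\<one>\<^bsub>opposite_group ?X\<^esub> = word_class rop []" for u v
    by (simp_all add: opposite_group_def mult_enveloping_group carrier_enveloping_group one_enveloping_group)
  define letter where "letter p = (if snd p then g (fst p) else inv (g (fst p)))" for p
  define val where "val u = foldr (\<lambda>p r. r \<otimes> letter p) u \<one>" for u
  have letter [simp]: "letter p \<in> carrier G" for p by (simp add: letter_def g)
  have [simp]: "val [] = \<one>" "val (p # u) = val u \<otimes> letter p" for p u by (simp_all add: val_def)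
  have val [simp]: "val u \<in> carrier G" for u by (induction u) auto
  have val_append: "val (u @ v) = val v \<otimes> val u" for u v
    by (induction u) (auto simp: m_assoc)
  have val_eq: "val u = val v" if "rack_word_eq rop u v" for u v
    using that
  proof induction
    case (cancel x s)
    then show ?case by (cases s) (simp_all add: letter_def g)
  next
    case (rel x y)
    then show ?case using assms(3)[of y x] by (simp add: letter_def g)
  qed (simp_all add: val_append)
  define h where "h = (\<lambda>A\<in>range (word_class rop). val (SOME u. A = word_class rop u))"
  have h: "h (word_class rop u) = val u" for u
  proof -
    let ?v = "SOME v. word_class rop u = word_class rop v"
    have "word_class rop u = word_class rop ?v" by (rule someI) simp
    then have "val u = val ?v" by (simp only: word_class_eq_iff val_eq)
    then show ?thesis by (simp add: h_def)
  qed
  have hom: "group_hom (opposite_group ?X) G h"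
    by unfold_locales (auto simp: hom_def op h val_append)
  have gen: "h (env_gen rop x) = g x" for x
    by (simp add: env_gen_def h letter_def g)
  have h_ext: "h \<in> extensional (carrier ?X)"
    by (simp add: h_def carrier_enveloping_group)
  have unique: "h' = h" if h': "h' \<in> extensional (carrier ?X)" "group_hom (opposite_group ?X) G h'"
      "\<forall>x. h' (env_gen rop x) = g x" for h'
  proof -
    interpret h': group_hom "opposite_group ?X" G h' by (rule h'(2))
    have letter': "h' (word_class rop [p]) = letter p" for p
    proof (cases "snd p")
      case True
      then show ?thesis using h'(3) by (cases p) (simp add: env_gen_def letter_def)
    next
      case False
      then obtain x where p: "p = (x, False)" by (cases p) auto
      have "h' (word_class rop [p]) \<otimes> h' (word_class rop [(x, True)]) =
          h' (word_class rop [p] \<otimes>\<^bsub>opposite_group ?X\<^esub> word_class rop [(x, True)])"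
        by (rule h'.hom_mult[symmetric]) (simp_all add: op)
      also have "\<dots> = h' \<one>\<^bsub>opposite_group ?X\<^esub>"
        using rack_word_eq.cancel[of rop x True] by (simp add: op p flip: word_class_eq_iff)
      finally have "h' (word_class rop [p]) \<otimes> g x = \<one>"
        using h'(3) by (simp add: env_gen_def)
      then have "inv (g x) = h' (word_class rop [p])"
        by (rule inv_equality) (simp_all add: g op h'.hom_closed)
      then show ?thesis by (simp add: p letter_def)
    qed
    have val': "h' (word_class rop u) = val u" for u
    proof (induction u)
      case Nil
      then show ?case using h'.hom_one by (simp add: op)
    next
      case (Cons p u)
      have "h' (word_class rop (p # u)) =
          h' (word_class rop u \<otimes>\<^bsub>opposite_group ?X\<^esub> word_class rop [p])"
        by (simp add: op)
      also have "\<dots> = h' (word_class rop u) \<otimes> h' (word_class rop [p])"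
        by (rule h'.hom_mult) (simp_all add: op)
      finally show ?case by (simp add: Cons letter')
    qed
    show ?thesis
      by (rule extensionalityI[OF h'(1) h_ext]) (auto simp: carrier_enveloping_group h val')
  qed
  show ?thesis
  proof (rule ex1I[of _ h])
    show "h \<in> extensional (carrier ?X) \<and> group_hom (opposite_group ?X) G h \<and> (\<forall>x. h (env_gen rop x) = g x)"
      by (intro conjI allI h_ext hom gen)
  qed (elim conjE, rule unique)
qed


section \<open>Realizations of racks\<close>

locale rack_realization =
  yetter_drinfeld scale comul counit antipode fscale act coact
  for scale :: "'k::field \<Rightarrow> 'h::ring_1 \<Rightarrow> 'h"
    and comul :: "'h \<Rightarrow> (('h \<times> 'h) \<Rightarrow>\<^sub>0 'k)"
    and counit :: "'h \<Rightarrow> 'k"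
    and antipode :: "'h \<Rightarrow> 'h"
    and act :: "'h \<Rightarrow> ('x \<Rightarrow>\<^sub>0 'k) \<Rightarrow> ('x \<Rightarrow>\<^sub>0 'k)"
    and coact :: "('x \<Rightarrow>\<^sub>0 'k) \<Rightarrow> (('h \<times> ('x \<Rightarrow>\<^sub>0 'k)) \<Rightarrow>\<^sub>0 'k)" +
  fixes rop :: "'x \<Rightarrow> 'x \<Rightarrow> 'x"
    and q :: "'x \<Rightarrow> 'x \<Rightarrow> 'k"
    and e :: "'x \<Rightarrow> 'x \<Rightarrow> 'h"
  assumes inj_rop: "inj (rop x)"
    and q_nonzero: "q x y \<noteq> 0"
    and braiding: "tensor_eq fscale fscale (yd_braiding act coact (fbasis x) (fbasis y))
      (fscale (q y x) (fbasis (fbasis y, fbasis (rop y x))))"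
    and coaction: "coaction_matrix scale coact e"
begin

lemma lookup_fbasis: "Poly_Mapping.lookup (fbasis a) b = (if a = b then 1 else 0 :: 'k)"
  by (simp add: lookup_single when_def)

lemma finite_row: "finite {y. e x y \<noteq> 0}"
  using coaction by (simp add: coaction_matrix_def)

lemma cv_fbasis:
  assumes C: "biform C"
  shows "cv (fbasis x) C = (\<Sum>y | e x y \<noteq> 0. C (e x y) (fbasis y))"
proof -
  have "cv (fbasis x) C = ev2 C (\<Sum>y | e x y \<noteq> 0. fbasis (e x y, fbasis y))"
    unfolding cv_def using coaction ev2_tensor_eq[OF C] by (simp add: coaction_matrix_def)
  then show ?thesis
    by (simp add: linear_form_sum[OF linear_form_ev2]) (simp add: ev2_def)
qed

text \<open>
  Taking the coordinate of \<open>w\<^sub>y\<close> in the coaction of \<open>w\<^sub>x\<close> extracts the coefficient \<open>e\<^sub>x\<^sub>y\<close>. Applied to the counit, to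
  coassociativity and to the braiding, this gives all that is needed about the coefficients.
\<close>

lemma cv_fbasis_coordinate:
  assumes f: "lin f"
  shows "cv (fbasis x) (\<lambda>m u. f m * Poly_Mapping.lookup u y) = f (e x y)"
proof -
  note [simp] = linear_form_add[OF f] linear_form_scale[OF f] linear_form_zero[OF f]
  have "cv (fbasis x) (\<lambda>m u. f m * Poly_Mapping.lookup u y) =
      (\<Sum>k | e x k \<noteq> 0. f (e x k) * Poly_Mapping.lookup (fbasis k) y)"
    by (rule cv_fbasis) (simp add: form_simps lookup_add)
  also have "\<dots> = f (e x y) * Poly_Mapping.lookup (fbasis y) y"
    by (rule sum_single[OF finite_row]) (simp_all add: lookup_fbasis)
  finally show ?thesis by (simp add: lookup_fbasis)
qed

lemma comatrix_coefficients: "comatrix e"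
  unfolding comatrix_def
proof (intro conjI allI)
  fix x y
  have "counit (e x y) = cv (fbasis x) (\<lambda>m u. counit m * Poly_Mapping.lookup u y)"
    by (simp add: cv_fbasis_coordinate[OF linear_counit])
  also have "\<dots> = Poly_Mapping.lookup (fbasis x) y"
    by (rule cv_counit[OF linear_form_lookup])
  finally show "counit (e x y) = (if x = y then 1 else 0)" by (simp add: lookup_fbasis)
next
  fix x
  have "sw (e x y) B = (\<Sum>k | e x k \<noteq> 0. B (e x k) (e k y))" if B: "bilin B" for y B
  proof -
    note [simp] = bilinear_formD[OF B]
    have "sw (e x y) B = cv (fbasis x) (\<lambda>m u. sw m B * Poly_Mapping.lookup u y)"
      by (simp add: cv_fbasis_coordinate[OF linear_sw[OF B]])
    also have "\<dots> = cv (fbasis x) (\<lambda>m u. sw m (\<lambda>a b. B a b * Poly_Mapping.lookup u y))"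
      by (simp add: sw_mult_right)
    also have "\<dots> = cv (fbasis x) (\<lambda>m u. cv u (\<lambda>b u'. B m b * Poly_Mapping.lookup u' y))"
      by (rule cv_coassoc) (simp add: form_simps lookup_add)
    also have "\<dots> = (\<Sum>k | e x k \<noteq> 0. cv (fbasis k) (\<lambda>b u'. B (e x k) b * Poly_Mapping.lookup u' y))"
      by (rule cv_fbasis) (simp add: yd_simps lookup_add mult.assoc)
    also have "\<dots> = (\<Sum>k | e x k \<noteq> 0. B (e x k) (e k y))"
      by (intro sum.cong refl cv_fbasis_coordinate) (use B in \<open>auto simp: bilinear_form_def\<close>)
    finally show ?thesis .
  qed
  then show "\<exists>F. finite F \<and> (\<forall>k. k \<notin> F \<longrightarrow> e x k = 0) \<and>
      (\<forall>y B. bilin B \<longrightarrow> sw (e x y) B = (\<Sum>k\<in>F. B (e x k) (e k y)))"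
    using finite_row by (intro exI[of _ "{k. e x k \<noteq> 0}"]) auto
qed

lemma cv_braiding:
  assumes D: "bilinear_form fscale fscale D"
  shows "cv (fbasis x) (\<lambda>m u. D (act m (fbasis y)) u) = q y x * D (fbasis y) (fbasis (rop y x))"
  using ev2_tensor_eq[OF D braiding[of x y]]
  by (simp add: yd_braiding_def cv_def ev2_def lin_ext_lin_ext case_prod_unfold
      linear_form_scale[OF linear_form_lin_ext])

lemma act_coefficient:
  "act (e x y) (fbasis z) = (if rop z x = y then fscale (q z x) (fbasis z) else 0)"
proof (rule poly_mapping_eqI)
  fix i
  have f: "lin (\<lambda>m. Poly_Mapping.lookup (act m (fbasis z)) i)"
    by (simp add: linear_form_def act_simps lookup_add)
  have "Poly_Mapping.lookup (act (e x y) (fbasis z)) i =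
      cv (fbasis x) (\<lambda>m u. Poly_Mapping.lookup (act m (fbasis z)) i * Poly_Mapping.lookup u y)"
    by (rule cv_fbasis_coordinate[OF f, symmetric])
  also have "\<dots> = q z x * (Poly_Mapping.lookup (fbasis z) i * Poly_Mapping.lookup (fbasis (rop z x)) y)"
    by (rule cv_braiding) (simp add: form_defs lookup_add algebra_simps)
  finally show "Poly_Mapping.lookup (act (e x y) (fbasis z)) i =
      Poly_Mapping.lookup (if rop z x = y then fscale (q z x) (fbasis z) else 0) i"
    by (simp add: lookup_fbasis)
qed

definition K :: "'h set"
  where "K = hopf_subalgebra_generated scale comul antipode {e x y | x y. True}"

lemma comul_coefficients_within:
  assumes "\<And>x y. e x y \<in> L"
  shows "comul_within L (e x y)"
proof -
  obtain F where "\<And>y B. bilin B \<Longrightarrow> sw (e x y) B = (\<Sum>k\<in>F. B (e x k) (e k y))"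
    using comatrix_coefficients unfolding comatrix_def by blast
  then show ?thesis using assms by (simp add: comul_within_def)
qed

lemma K_eq: "K = algebra_generated (antipode_orbit {e x y | x y. True})"
  and hopf_subalgebra_K: "hopf_subalgebra scale comul antipode K"
proof -
  let ?E = "{e x y | x y. True}"
  have "e x y \<in> algebra_generated (antipode_orbit ?E)" for x y
    by (rule antipode_orbit_base) blast
  then have within: "comul_within (algebra_generated (antipode_orbit ?E)) a" if "a \<in> ?E" for a
    using that comul_coefficients_within by auto
  show "K = algebra_generated (antipode_orbit ?E)" "hopf_subalgebra scale comul antipode K"
    unfolding K_def using hopf_subalgebra_generated_by_antipode_orbit[OF within] by auto
qed

lemma K_closed:
  "1 \<in> K" "a \<in> K \<Longrightarrow> b \<in> K \<Longrightarrow> a + b \<in> K" "a \<in> K \<Longrightarrow> scale c a \<in> K" "a \<in> K \<Longrightarrow> b \<in> K \<Longrightarrow> a * b \<in> K"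
  "e x y \<in> K"
proof -
  show "1 \<in> K" "a \<in> K \<Longrightarrow> b \<in> K \<Longrightarrow> a + b \<in> K" "a \<in> K \<Longrightarrow> scale c a \<in> K" "a \<in> K \<Longrightarrow> b \<in> K \<Longrightarrow> a * b \<in> K"
    using hopf_subalgebra_K by (simp_all add: hopf_subalgebra_def subspace_add subspace_scale)
  show "e x y \<in> K" unfolding K_def hopf_subalgebra_generated_def by auto
qed

text \<open>
  By induction over the generation of \<open>K\<close>: the elements that preserve a line form a subalgebra, and the antipode
  orbit of the coefficients lies in it.
\<close>

lemma K_preserves_lines:
  assumes "a \<in> K"
  shows "\<exists>c. act a (fbasis z) = fscale c (fbasis z)"
  using assms unfolding K_eq
proof induction
  case (gen g)
  then obtain n x y where g: "g = (antipode ^^ n) (e x y)" by (auto simp: antipode_orbit_def)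
  show ?case
    unfolding g
    by (rule antipode_orbit_acts_diagonally[OF comatrix_coefficients inj_rop[of z] _ act_coefficient])
      (rule q_nonzero)
next
  case one
  then show ?case by (metis act_one V.scale_one)
next
  case (add a b)
  then show ?case by (metis act_add_left V.scale_left_distrib)
next
  case (scale a c)
  then show ?case by (metis act_scale_left V.scale_scale)
next
  case (mult a b)
  then show ?case by (metis act_mult act_simps(4) V.scale_scale)
qed

abbreviation "\<theta> \<equiv> line_character K act"

lemma act_line:
  assumes "a \<in> K"
  shows "act a (fbasis z) = fscale (\<theta> z a) (fbasis z)"
proof -
  obtain c where c: "act a (fbasis z) = fscale c (fbasis z)"
    using K_preserves_lines[OF assms] by blast
  have unique: "c' = c" if "fscale c (fbasis z) = fscale c' (fbasis z)" for c' :: 'k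
    using arg_cong[OF that, of "\<lambda>v. Poly_Mapping.lookup v z"] by (simp add: lookup_fbasis)
  have "\<theta> z a = c"
    using assms c unique by (auto simp: line_character_def intro!: the_equality)
  with c show ?thesis by simp
qed

lemma line_character_eq: "a \<in> K \<Longrightarrow> \<theta> z a = Poly_Mapping.lookup (act a (fbasis z)) z"
  by (simp add: act_line lookup_fbasis)

lemma line_character_coefficient: "\<theta> z (e x y) = (if rop z x = y then q z x else 0)"
  by (simp add: line_character_eq K_closed act_coefficient lookup_fbasis)

lemma line_character_alg_map: "\<theta> z \<in> alg_maps scale K"
proof -
  have "\<theta> z (a * b) = \<theta> z a * \<theta> z b" if "a \<in> K" "b \<in> K" for a b
    using that by (simp add: line_character_eq[of "a * b"] K_closed act_mult act_line act_simps lookup_fbasis)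
  moreover have "\<theta> z \<in> extensional K" by (simp add: line_character_def)
  ultimately show ?thesis
    by (simp add: alg_maps_def K_closed line_character_eq act_simps lookup_add act_one lookup_fbasis)
qed

text \<open>
  The braiding maps \<open>w\<^sub>z \<otimes> w\<^sub>t\<close> to a nonzero multiple of \<open>w\<^sub>t \<otimes> w\<^bsub>t\<rhd>z\<^esub>\<close>, and \<open>K\<close> acts on these two lines by the two
  convolution products. As the braiding commutes with the action, the two characters agree.
\<close>

proposition line_character_exchange:
  "convolution scale comul K (\<theta> z) (\<theta> t) = convolution scale comul K (\<theta> t) (\<theta> (rop t z))"
proof (rule extensionalityI[of _ K])
  fix a assume a: "a \<in> K"
  \<comment> \<open>The coordinate of the action on the line is a linear form on all of \<open>H\<close> that extends the character.\<close>
  let ?l = "\<lambda>z a. Poly_Mapping.lookup (act a (fbasis z)) z"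
  have l: "lin (?l z)" for z by (simp add: linear_form_def act_simps lookup_add)
  have conv: "convolution scale comul K (\<theta> z) (\<theta> t) a = sw a (\<lambda>x y. ?l z x * ?l t y)" for z t
    by (rule convolution_extension[OF hopf_subalgebra_K l _ l _ a]) (simp_all add: line_character_eq)
  \<comment> \<open>The coordinate of \<open>w\<^sub>t \<otimes> w\<^bsub>t\<rhd>z\<^esub>\<close> in the tensor square.\<close>
  let ?D = "\<lambda>v w. Poly_Mapping.lookup v t * Poly_Mapping.lookup w (rop t z)"
  have D: "bilinear_form fscale fscale ?D"
    by (simp add: form_defs lookup_add algebra_simps)
  have D': "bilinear_form fscale fscale (\<lambda>v w. sw a (\<lambda>x y. ?D (act x v) (act y w)))"
    by (simp add: yd_simps lookup_add mult.assoc)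
  have "q t z * convolution scale comul K (\<theta> z) (\<theta> t) a = sw a (\<lambda>x y. q t z * (?l z x * ?l t y))"
    by (simp add: conv sw_cmult)
  also have "\<dots> = sw a (\<lambda>x y. cv (act x (fbasis z)) (\<lambda>m u. ?D (act m (act y (fbasis t))) u))"
  proof (rule sw_cong_within)
    show "comul_within K a"
      using hopf_subalgebra_K a by (simp add: hopf_subalgebra_def comul_within_iff)
    show "bilin (\<lambda>x y. q t z * (?l z x * ?l t y))"
      by (simp add: yd_simps lookup_add)
    show "bilin (\<lambda>x y. cv (act x (fbasis z)) (\<lambda>m u. ?D (act m (act y (fbasis t))) u))"
      by (simp add: yd_simps lookup_add mult.assoc)
    show "q t z * (?l z x * ?l t y) = cv (act x (fbasis z)) (\<lambda>m u. ?D (act m (act y (fbasis t))) u)"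
      if "x \<in> K" "y \<in> K" for x y
    proof -
      have "biform (\<lambda>m u. ?D (act m (fbasis t)) u)"
        by (simp add: yd_simps lookup_add)
      then have "cv (act x (fbasis z)) (\<lambda>m u. ?D (act m (act y (fbasis t))) u) =
          \<theta> z x * (\<theta> t y * cv (fbasis z) (\<lambda>m u. ?D (act m (fbasis t)) u))"
        using that by (simp add: act_line act_simps cv_scale cv_cmult mult.assoc)
      also have "\<dots> = \<theta> z x * (\<theta> t y * (q t z * ?D (fbasis t) (fbasis (rop t z))))"
        by (simp only: cv_braiding[OF D])
      finally show ?thesis using that by (simp add: line_character_eq lookup_fbasis)
    qed
  qed
  also have "\<dots> = cv (fbasis z) (\<lambda>m u. sw a (\<lambda>x y. ?D (act x (act m (fbasis t))) (act y u)))"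
    by (rule braiding_H_linear[OF D])
  also have "\<dots> = q t z * sw a (\<lambda>x y. ?D (act x (fbasis t)) (act y (fbasis (rop t z))))"
    by (rule cv_braiding[OF D'])
  also have "\<dots> = q t z * convolution scale comul K (\<theta> t) (\<theta> (rop t z)) a"
    by (simp add: conv)
  finally show "convolution scale comul K (\<theta> z) (\<theta> t) a = convolution scale comul K (\<theta> t) (\<theta> (rop t z)) a"
    using q_nonzero by simp
qed (simp_all add: convolution_def)

text \<open>
  The coefficient \<open>e\<^sub>x\<^sub>y\<close> with \<open>y = z \<rhd> x\<close> separates the characters of \<open>z\<close> and \<open>t\<close> as soon as
  \<open>z \<rhd> x \<noteq> t \<rhd> x\<close>; and distinct multiplicative maps are independent.
\<close>

lemma line_characters_independent:
  assumes "inj rop"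
  shows "independent_family_on K \<theta>"
proof (rule independent_multiplicative_family)
  fix z t :: 'x assume "z \<noteq> t"
  then have "rop z \<noteq> rop t" using assms by (auto dest: injD)
  then obtain x where "rop z x \<noteq> rop t x" by blast
  then have "\<theta> z (e x (rop z x)) \<noteq> \<theta> t (e x (rop z x))"
    using q_nonzero by (simp add: line_character_coefficient)
  then show "\<exists>a\<in>K. \<theta> z a \<noteq> \<theta> t a" using K_closed(5) by blast
qed (use line_character_alg_map K_closed in \<open>auto simp: alg_maps_def\<close>)

end

theorem proposition4p16:
  fixes rop :: "'x \<Rightarrow> 'x \<Rightarrow> 'x"
    and q :: "'x \<Rightarrow> 'x \<Rightarrow> 'k::{alg_closed_field, field_char_0}"
    and scale :: "'k \<Rightarrow> 'h::ring_1 \<Rightarrow> 'h"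
    and comul :: "'h \<Rightarrow> (('h \<times> 'h) \<Rightarrow>\<^sub>0 'k)"
    and counit :: "'h \<Rightarrow> 'k"
    and antipode :: "'h \<Rightarrow> 'h"
    and act :: "'h \<Rightarrow> ('x \<Rightarrow>\<^sub>0 'k) \<Rightarrow> ('x \<Rightarrow>\<^sub>0 'k)"
    and coact :: "('x \<Rightarrow>\<^sub>0 'k) \<Rightarrow> (('h \<times> ('x \<Rightarrow>\<^sub>0 'k)) \<Rightarrow>\<^sub>0 'k)"
    and e :: "'x \<Rightarrow> 'x \<Rightarrow> 'h"
  defines "K \<equiv> hopf_subalgebra_generated scale comul antipode {e x y | x y. True}"
  defines "\<theta> \<equiv> line_character K act"
  defines "AlgK \<equiv> Alg scale comul counit K"
  assumes "rack rop"
    and "rack_cocycle rop q"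
    and "hopf_algebra scale comul counit antipode"
    and "realization rop q scale comul counit antipode act coact"
    and "coaction_matrix scale coact e"
  shows "(\<forall>z. \<theta> z \<in> carrier AlgK \<and>
             (\<forall>a\<in>K. act a (fbasis z) = fscale (\<theta> z a) (fbasis z)) \<and>
             (\<forall>x y. \<theta> z (e x y) = (if rop z x = y then q z x else 0))) \<and>
         (\<forall>z t. \<theta> z \<otimes>\<^bsub>AlgK\<^esub> \<theta> t = \<theta> t \<otimes>\<^bsub>AlgK\<^esub> \<theta> (rop t z)) \<and>
         (\<exists>!h. h \<in> extensional (carrier (enveloping_group rop)) \<and>
               group_hom (opposite_group (enveloping_group rop)) AlgK h \<and>
               (\<forall>x. h (env_gen rop x) = \<theta> x)) \<and>
         (faithful_rack rop \<longrightarrow> independent_family_on K \<theta>)"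
proof -
  interpret yetter_drinfeld scale comul counit antipode fscale act coact
    using assms(7) by (simp add: realization_def)
  interpret R: rack_realization scale comul counit antipode act coact rop q e
    using assms(4,5,7,8)
    by unfold_locales (auto simp: rack_def rack_cocycle_def realization_def bij_is_inj)
  have K: "K = R.K" by (simp add: K_def R.K_def)
  have \<theta>: "\<theta> = R.\<theta>" by (simp add: \<theta>_def K)
  have carrier: "\<theta> z \<in> carrier AlgK" for z
    using R.line_character_alg_map by (simp add: AlgK_def Alg_def \<theta> K)
  have exchange: "\<theta> z \<otimes>\<^bsub>AlgK\<^esub> \<theta> t = \<theta> t \<otimes>\<^bsub>AlgK\<^esub> \<theta> (rop t z)" for z t
    using R.line_character_exchange by (simp add: AlgK_def Alg_def \<theta> K)
  have group: "group AlgK"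
    unfolding AlgK_def K by (rule group_Alg[OF R.hopf_subalgebra_K])
  show ?thesis
  proof (intro conjI allI ballI impI)
    show "act a (fbasis z) = fscale (\<theta> z a) (fbasis z)" if "a \<in> K" for a z
      using R.act_line that by (simp add: \<theta> K)
    show "\<theta> z (e x y) = (if rop z x = y then q z x else 0)" for x y z
      using R.line_character_coefficient by (simp add: \<theta>)
    show "\<exists>!h. h \<in> extensional (carrier (enveloping_group rop)) \<and>
        group_hom (opposite_group (enveloping_group rop)) AlgK h \<and> (\<forall>x. h (env_gen rop x) = \<theta> x)"
      by (rule enveloping_group_universal[OF group carrier exchange])
    show "independent_family_on K \<theta>" if "faithful_rack rop"
      using R.line_characters_independent that by (simp add: faithful_rack_def \<theta> K)
  qed (fact carrier exchange)+
qed

end
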